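(* Let $\Omega\subseteq\mathbb{R}^n$ and $f:\Omega\to\mathbb{R}^n$ with $f(0)=0$ and solution map $\phi_f$, let $G\subseteq\Omega$ be forward invariant for $f$, and let $\alpha:G\to\mathbb{R}_+$ be continuous. For $\rho:\mathbb{R}_+\to\mathbb{R}$ continuous on $(0,\infty)$, let $\beta:\mathbb{R}_+\times\mathbb{R}_+\to\mathbb{R}_+$ be the unique continuous function satisfying $\beta(y,0)=y$ and $\partial_t\beta(y,t)=\rho(\beta(y,t))$ for all $y,t\ge0$. Suppose that $\alpha$ is positive definite and coercive, that $\beta(y,t)$ is monotonically decreasing in $t$ for $y>0$, and that $f$, $\alpha$, and $\beta$ are locally Lipschitz continuous. Let $k\ge0$ and $M\ge1$. Then $f$ is $\beta$-stable on $G$ with respect to $\alpha$ and with rate $k$ and gain $M$ if and only if for every $\epsilon\in(0,1)$ there exists a continuous function $V_\epsilon:G\to\mathbb{R}_+$ which is locally Lipschitz on $G\setminus\{0\}$ and satisfies $$M^{-1}\alpha(x)\le V_\epsilon(x)\le\alpha(x)\quad\forall x\in G,\qquad \nabla V_\epsilon(x)^Tf(x)\le(1-\epsilon)k\,\rho(V_\epsilon(x))\quad\text{for a.e. }x\in G.$$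
   Context: $\mathbb{R}_+=[0,\infty)$. For $f:\Omega\to\mathbb{R}^n$, $\phi_f$ denotes the solution map of the ODE: $\partial_t\phi_f(x,t)=f(\phi_f(x,t))$, $\phi_f(x,0)=x$. Standing assumption: $\phi_f$ is well-defined, unique, jointly continuous in $(x,t)$, and satisfies $\phi_f(\phi_f(x,t),s)=\phi_f(x,t+s)$ for $t,s\ge0$. $G\subseteq\Omega$ is forward invariant for $f$ if $\phi_f(x,t)\in G$ for all $x\in G$, $t\ge 0$. $f$ is $\beta$-stable on $G$ with respect to $\alpha$ with rate $k\ge0$ and gain $M\ge1$ if $\alpha(\phi_f(x,t))\le M\beta(\alpha(x),kt)$ for all $x\in G$, $t\ge0$. $\alpha$ is positive definite if $\alpha(x)=0$ if and only if $x=0$, and coercive if $\|x\|_2\to\infty$ implies $\alpha(x)\to\infty$. "Monotonically decreasing" means strictly decreasing. "The unique continuous function satisfying ..." means that it is assumed that exactly one continuous $\beta$ with the stated properties exists.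
   Formalization: "Stable implies V_ε exists" is stated only for k>0 or M=1 (it is false for k=0, M>1); "V_ε exists implies stable" is stated only for G having no nonzero point near which G is Lebesgue null (on a null G the a.e. condition is vacuous). *)

theory Defs
  imports "HOL-Analysis.Analysis"
begin

definition locally_lipschitz_on ::
    "'a::metric_space set \<Rightarrow> ('a \<Rightarrow> 'b::metric_space) \<Rightarrow> bool" where
  "locally_lipschitz_on S f \<longleftrightarrow>
     (\<forall>x\<in>S. \<exists>r>0. \<exists>L. L-lipschitz_on (ball x r \<inter> S) f)"

(* A partial map with domain Omega (or G, or a half-line) is a total function of which only the
   values on the domain matter; one-sided derivatives at t = 0 are expressed by "within {0..}". *)

definition ode_solution ::
    "'a::real_normed_vector set \<Rightarrow> ('a \<Rightarrow> 'a) \<Rightarrow> 'a \<Rightarrow> (real \<Rightarrow> 'a) \<Rightarrow> bool" where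
  "ode_solution \<Omega> f x u \<longleftrightarrow>
     u 0 = x \<and>
     (\<forall>t\<ge>0. u t \<in> \<Omega> \<and> (u has_vector_derivative f (u t)) (at t within {0..}))"

definition solution_map ::
    "'a::real_normed_vector set \<Rightarrow> ('a \<Rightarrow> 'a) \<Rightarrow> ('a \<Rightarrow> real \<Rightarrow> 'a) \<Rightarrow> bool" where
  "solution_map \<Omega> f \<phi> \<longleftrightarrow>
     (\<forall>x\<in>\<Omega>. ode_solution \<Omega> f x (\<phi> x)) \<and>
     (\<forall>x\<in>\<Omega>. \<forall>u. ode_solution \<Omega> f x u \<longrightarrow> (\<forall>t\<ge>0. u t = \<phi> x t)) \<and>
     continuous_on (\<Omega> \<times> {0..}) (\<lambda>(x, t). \<phi> x t) \<and>
     (\<forall>x\<in>\<Omega>. \<forall>t\<ge>0. \<forall>s\<ge>0. \<phi> (\<phi> x t) s = \<phi> x (t + s))"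

definition forward_invariant :: "('a \<Rightarrow> real \<Rightarrow> 'a) \<Rightarrow> 'a set \<Rightarrow> bool" where
  "forward_invariant \<phi> G \<longleftrightarrow> (\<forall>x\<in>G. \<forall>t\<ge>0. \<phi> x t \<in> G)"

definition comparison_solution ::
    "(real \<Rightarrow> real) \<Rightarrow> (real \<Rightarrow> real \<Rightarrow> real) \<Rightarrow> bool" where
  "comparison_solution \<rho> \<beta> \<longleftrightarrow>
     (\<forall>y\<ge>0. \<forall>t\<ge>0. 0 \<le> \<beta> y t) \<and>
     continuous_on ({0..} \<times> {0..}) (\<lambda>(y, t). \<beta> y t) \<and>
     (\<forall>y\<ge>0. \<beta> y 0 = y) \<and>
     (\<forall>y\<ge>0. \<forall>t\<ge>0. (\<beta> y has_real_derivative \<rho> (\<beta> y t)) (at t within {0..}))"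

definition unique_comparison_solution ::
    "(real \<Rightarrow> real) \<Rightarrow> (real \<Rightarrow> real \<Rightarrow> real) \<Rightarrow> bool" where
  "unique_comparison_solution \<rho> \<beta> \<longleftrightarrow>
     comparison_solution \<rho> \<beta> \<and>
     (\<forall>\<gamma>. comparison_solution \<rho> \<gamma> \<longrightarrow> (\<forall>y\<ge>0. \<forall>t\<ge>0. \<gamma> y t = \<beta> y t))"

definition positive_definite_on :: "'a::zero set \<Rightarrow> ('a \<Rightarrow> real) \<Rightarrow> bool" where
  "positive_definite_on G \<alpha> \<longleftrightarrow> (\<forall>x\<in>G. \<alpha> x = 0 \<longleftrightarrow> x = 0)"

definition coercive_on :: "'a::real_normed_vector set \<Rightarrow> ('a \<Rightarrow> real) \<Rightarrow> bool" where
  "coercive_on G \<alpha> \<longleftrightarrow> filterlim \<alpha> at_top (inf at_infinity (principal G))"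

definition beta_stable_on ::
    "'a set \<Rightarrow> ('a \<Rightarrow> real \<Rightarrow> 'a) \<Rightarrow> ('a \<Rightarrow> real) \<Rightarrow> (real \<Rightarrow> real \<Rightarrow> real) \<Rightarrow> real \<Rightarrow> real \<Rightarrow> bool" where
  "beta_stable_on G \<phi> \<alpha> \<beta> k M \<longleftrightarrow>
     (\<forall>x\<in>G. \<forall>t\<ge>0. \<alpha> (\<phi> x t) \<le> M * \<beta> (\<alpha> x) (k * t))"

(* V is defined on G only, so its gradient at x is the vector g representing the derivative of V
   at x within G.  At interior points of G this is the usual gradient; at Lebesgue-almost every
   point of any set G such a vector is unique if it exists.  Existence of the gradient is part
   of the almost-everywhere condition. *)
definition lyapunov_function ::
    "('a::euclidean_space \<Rightarrow> 'a) \<Rightarrow> 'a set \<Rightarrow> ('a \<Rightarrow> real) \<Rightarrow> (real \<Rightarrow> real) \<Rightarrow>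
     real \<Rightarrow> real \<Rightarrow> real \<Rightarrow> ('a \<Rightarrow> real) \<Rightarrow> bool" where
  "lyapunov_function f G \<alpha> \<rho> k M \<epsilon> V \<longleftrightarrow>
     (\<forall>x\<in>G. 0 \<le> V x) \<and>
     continuous_on G V \<and>
     locally_lipschitz_on (G - {0}) V \<and>
     (\<forall>x\<in>G. inverse M * \<alpha> x \<le> V x \<and> V x \<le> \<alpha> x) \<and>
     (AE x in lebesgue. x \<in> G \<longrightarrow>
        (\<exists>g. (V has_derivative (\<lambda>h. g \<bullet> h)) (at x within G) \<and>
             g \<bullet> f x \<le> (1 - \<epsilon>) * k * \<rho> (V x)))"

(* "Almost every x in G" constrains V only on parts of G that are not Lebesgue null: on a null
   set G the gradient inequality is vacuous.  Every open G, and every G contained in the closure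
   of its interior, satisfies this. *)
definition locally_nonnull :: "'a::euclidean_space set \<Rightarrow> bool" where
  "locally_nonnull G \<longleftrightarrow> (\<forall>x\<in>G - {0}. \<forall>r>0. \<not> negligible (ball x r \<inter> G))"

end

theory Submission
  imports Defs
begin

text \<open>
The proof rests on two reductions. First, \<open>\<rho>\<close> is negative on the positive half-line: the solution family
\<open>\<beta>\<close> is a semigroup by uniqueness, and a positive zero of \<open>\<rho>\<close> would force a constant solution by the
Lipschitz continuity of \<open>\<beta>\<close> (\<open>rho_neg\<close>). So \<open>- 1 / \<rho>\<close> has a primitive, \<open>time_coord\<close>, in which the comparison
equation is motion with velocity \<open>-1\<close>. Stability and the Lyapunov inequality both become statements about
linear decay of this coordinate along orbits.

Second, Lipschitz functions are differentiable almost everywhere. This is Rademacher's theorem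
(\<open>Rademacher\<close>), and it is proved here from the one-dimensional case, in which a Lipschitz function is
the integral of its derivative (\<open>lipschitz_real_integral_of_derivative\<close>).

A stable system with positive rate has the Lyapunov function whose coordinate is the supremum over
\<open>t \<ge> 0\<close> of \<open>time_coord (\<alpha> (\<phi> x t) / M) + (1 - \<epsilon>) * k * t\<close>. The supremum absorbs the gain \<open>M\<close>, it decreases at
the rate \<open>(1 - \<epsilon>) * k\<close> along orbits by construction, and the lost fraction \<open>\<epsilon>\<close> of the rate makes it locally
a supremum over a compact time interval, hence locally Lipschitz. Its gradient exists almost everywhere
by Rademacher's theorem and inherits the decay (\<open>lyapunov_function_lyap\<close>).

Conversely, the Lyapunov inequality can fail only on a null set. The flow is locally bi-Lipschitz, so by
Fubini's theorem almost every orbit meets this null set for a null set of times only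
(\<open>negligible_flow_preimage\<close>). Along such an orbit the coordinate of \<open>V\<close> is Lipschitz in time, and its
derivative is at most \<open>- (1 - \<epsilon>) * k\<close> at almost every time, so integration gives the decay. Continuity extends the
estimate to all orbits, because no relatively open part of \<open>G - {0}\<close> is null, and \<open>\<epsilon> \<rightarrow> 0\<close> gives the full
rate (\<open>stable_if_lyapunov_functions\<close>).
\<close>

section \<open>Lipschitz functions of one real variable\<close>

lemma emeasure_UN_countable_le:
  assumes "countable I" and [measurable]: "\<And>i. i \<in> I \<Longrightarrow> X i \<in> sets M"
  shows "emeasure M (\<Union>i\<in>I. X i) \<le> (\<integral>\<^sup>+i. emeasure M (X i) \<partial>count_space I)"
proof -
  have "emeasure M (\<Union>i\<in>I. X i) = (\<integral>\<^sup>+x. indicator (\<Union>i\<in>I. X i) x \<partial>M)"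
    using assms by (simp add: sets.countable_UN'' )
  also have "\<dots> \<le> (\<integral>\<^sup>+x. (\<integral>\<^sup>+i. indicator (X i) x \<partial>count_space I) \<partial>M)"
  proof (rule nn_integral_mono)
    fix x
    show "indicator (\<Union>i\<in>I. X i) x \<le> (\<integral>\<^sup>+i. indicator (X i) x \<partial>count_space I)"
    proof (cases "x \<in> (\<Union>i\<in>I. X i)")
      case True
      then obtain i where "i \<in> I" "x \<in> X i" by blast
      then show ?thesis using nn_integral_ge_point[of i I "\<lambda>i. indicator (X i) x"] using True by (simp only: indicator_simps)
    qed simp
  qed
  also have "\<dots> = (\<integral>\<^sup>+i. (\<integral>\<^sup>+x. indicator (X i) x \<partial>M) \<partial>count_space I)"
    by (intro nn_integral_count_space_nn_integral) (use assms in auto)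
  also have "\<dots> = (\<integral>\<^sup>+i. emeasure M (X i) \<partial>count_space I)"
    by (intro nn_integral_cong) auto
  finally show ?thesis .
qed

text \<open>A null set has an open neighbourhood of measure \<open>e\<close>. The Vitali lemma selects disjoint balls in
this neighbourhood whose fivefold enlargements cover the null set. The Lipschitz bound gives each
enlargement Stieltjes measure at most \<open>5 * K\<close> times the length of the ball.\<close>

lemma interval_measure_lipschitz_absolutely_continuous:
  fixes H :: "real \<Rightarrow> real"
  assumes mono: "\<And>x y. x \<le> y \<Longrightarrow> H x \<le> H y" and lip: "K-lipschitz_on UNIV H"
  shows "absolutely_continuous lborel (interval_measure H)"
proof -
  have K: "0 \<le> K" using lip lipschitz_on_nonneg by blast
  have contH: "continuous_on UNIV H" using lip by (rule lipschitz_on_continuous_on)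
  then have cont: "continuous (at_right a) H" "isCont H a" for a
    using continuous_at_imp_continuous_at_within[of a H]
    by (simp_all add: continuous_on_eq_continuous_at)
  have interval: "emeasure (interval_measure H) (cball x r) \<le> ennreal (K * (2 * r))" if "r \<ge> 0" for x r
  proof -
    have "emeasure (interval_measure H) {x-r..x+r} = H (x+r) - H (x-r)"
      using that mono contH
      by (intro emeasure_interval_measure_Icc) (auto intro: continuous_on_subset)
    moreover have "H (x+r) - H (x-r) \<le> K * (2*r)"
      using lipschitz_onD[OF lip, of "x+r" "x-r"] that by (simp add: dist_real_def)
    ultimately show ?thesis by (simp add: cball_eq_atLeastAtMost ennreal_leI)
  qed
  show ?thesis unfolding absolutely_continuous_def
  proof
    fix N :: "real set" assume N: "N \<in> null_sets lborel"
    have bound: "emeasure (interval_measure H) N \<le> ennreal (5 * K * e)" if "e > 0" for e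
    proof -
      obtain W where W: "open W" "N \<subseteq> W" "emeasure lebesgue (W - N) < ennreal e"
      proof -
        have "N \<in> sets lebesgue" using null_setsD2[OF N] by simp
        from sets_lebesgue_outer_open[OF this \<open>e > 0\<close>] that show thesis by metis
      qed
      have We: "emeasure lebesgue W \<le> ennreal e"
      proof -
        have "N \<in> null_sets lebesgue" using N by (rule null_sets_completionI)
        then have "emeasure lebesgue (W - N) = emeasure lebesgue W"
          using W(1) by (intro emeasure_Diff_null_set) auto
        then show ?thesis using W(3) by simp
      qed
      define I where "I = {(x,r). x \<in> N \<and> 0 < r \<and> r \<le> 1 \<and> cball x r \<subseteq> W}"
      have cover: "N \<subseteq> (\<Union>i\<in>I. cball (fst i) (snd i))"
      proof
        fix x assume "x \<in> N"
        then obtain r where "r > 0" "cball x r \<subseteq> W"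
          using W(1,2) unfolding open_contains_cball by blast
        then have "(x, min r 1) \<in> I"
          using \<open>x \<in> N\<close> min.coboundedI1 subset_cball[of "min r 1" r x] by (auto simp: I_def)
        then show "x \<in> (\<Union>i\<in>I. cball (fst i) (snd i))"
          using \<open>r > 0\<close> by (intro UN_I[of "(x, min r 1)"]) simp_all
      qed
      obtain C where C: "countable C" "C \<subseteq> I"
        "pairwise (\<lambda>i j. disjnt (cball (fst i) (snd i)) (cball (fst j) (snd j))) C"
        "N \<subseteq> (\<Union>i\<in>C. cball (fst i) (5 * snd i))"
      proof (rule Vitali_covering_lemma_cballs[OF cover, where B = 1])
        show "0 < snd i \<and> snd i \<le> 1" if "i \<in> I" for i using that by (auto simp: I_def)
      qed
      have disj: "disjoint_family_on (\<lambda>i. cball (fst i) (snd i)) C"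
        using C(3) by (auto simp: disjoint_family_on_def pairwise_def disjnt_def)
      have pos: "0 \<le> snd i" if "i \<in> C" for i using that C(2) by (auto simp: I_def)
      have "emeasure (interval_measure H) N
          \<le> emeasure (interval_measure H) (\<Union>i\<in>C. cball (fst i) (5 * snd i))"
        using C(1,4) by (intro emeasure_mono) (auto intro!: sets.countable_UN')
      also have "\<dots> \<le> (\<integral>\<^sup>+i. emeasure (interval_measure H) (cball (fst i) (5 * snd i)) \<partial>count_space C)"
        using C(1) by (intro emeasure_UN_countable_le) auto
      also have "\<dots> \<le> (\<integral>\<^sup>+i. ennreal (5 * K) * emeasure lborel (cball (fst i) (snd i)) \<partial>count_space C)"
      proof (rule nn_integral_mono)
        fix i assume "i \<in> space (count_space C)"
        then have "0 \<le> snd i" using pos by simp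
        have "emeasure (interval_measure H) (cball (fst i) (5 * snd i)) \<le> ennreal (K * (2 * (5 * snd i)))"
          using interval[of "5 * snd i" "fst i"] \<open>0 \<le> snd i\<close> by simp
        also have "K * (2 * (5 * snd i)) = (5 * K) * (2 * snd i)" by simp
        also have "ennreal \<dots> = ennreal (5 * K) * ennreal (2 * snd i)"
          using K \<open>0 \<le> snd i\<close> by (intro ennreal_mult) auto
        also have "ennreal (2 * snd i) = emeasure lborel (cball (fst i) (snd i))"
          using \<open>0 \<le> snd i\<close> by (simp add: cball_eq_atLeastAtMost)
        finally show "emeasure (interval_measure H) (cball (fst i) (5 * snd i))
              \<le> ennreal (5 * K) * emeasure lborel (cball (fst i) (snd i))" .
      qed
      also have "\<dots> = ennreal (5 * K) * emeasure lborel (\<Union>i\<in>C. cball (fst i) (snd i))"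
        using C(1) disj by (subst emeasure_UN_countable) (auto simp: nn_integral_cmult)
      also have "\<dots> \<le> ennreal (5 * K) * emeasure lebesgue W"
      proof (intro mult_left_mono)
        have "(\<Union>i\<in>C. cball (fst i) (snd i)) \<subseteq> W" using C(2) unfolding I_def by fastforce
        then show "emeasure lborel (\<Union>i\<in>C. cball (fst i) (snd i)) \<le> emeasure lebesgue W"
          using W(1) by (simp add: emeasure_mono)
      qed simp
      also have "\<dots> \<le> ennreal (5 * K) * ennreal e" using We by (rule mult_left_mono) simp
      also have "\<dots> = ennreal (5 * K * e)" using K that by (intro ennreal_mult[symmetric]) auto
      finally show ?thesis .
    qed
    have small: "emeasure (interval_measure H) N \<le> ennreal e" if "e > 0" for e
    proof -
      have "emeasure (interval_measure H) N \<le> ennreal (5 * K * (e / (5 * K + 1)))"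
        using K that by (intro bound) auto
      also have "\<dots> \<le> ennreal e" using K that by (intro ennreal_leI) (simp add: field_simps)
      finally show ?thesis .
    qed
    have "emeasure (interval_measure H) N \<le> 0"
      by (rule ennreal_le_epsilon, simp only: add_0, rule small)
    then have zero: "emeasure (interval_measure H) N = 0" by (simp only: le_zero_eq)
    have "N \<in> sets (interval_measure H)" using null_setsD2[OF N] by simp
    then show "N \<in> null_sets (interval_measure H)" by (rule null_setsI[OF zero])
  qed
qed

text \<open>Adding \<open>K * x\<close> makes a \<open>K\<close>-Lipschitz function increasing, so it has a Stieltjes measure, and this
measure has a Radon-Nikodym density. The function is thus the integral of a locally integrable
function, and such an integral is differentiable almost everywhere.\<close>

lemma lipschitz_real_integral_of_derivative:
  fixes F :: "real \<Rightarrow> real"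
  assumes lip: "K-lipschitz_on UNIV F"
  obtains g N where "negligible N" "\<And>a b. a \<le> b \<Longrightarrow> (g has_integral F b - F a) {a..b}"
    "\<And>x. x \<notin> N \<Longrightarrow> (F has_real_derivative g x) (at x)"
proof -
  have K: "0 \<le> K" using lip lipschitz_on_nonneg by blast
  have lipD: "\<bar>F x - F y\<bar> \<le> K * \<bar>x - y\<bar>" for x y
    using lipschitz_onD[OF lip, of x y] by (simp add: dist_real_def)
  define H where "H x = F x + K * x" for x
  have mono: "H x \<le> H y" if "x \<le> y" for x y
    using lipD[of x y] that by (simp add: H_def algebra_simps)
  have lipH: "(K + K)-lipschitz_on UNIV H"
    unfolding H_def by (intro lipschitz_on_add lip lipschitz_onI) (auto simp: dist_real_def K abs_mult simp flip: right_diff_distrib)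
  have contH: "continuous_on UNIV H" by (rule lipschitz_on_continuous_on[OF lipH])
  have "absolutely_continuous lborel (interval_measure H)"
    using interval_measure_lipschitz_absolutely_continuous[OF mono lipH] .
  then have "\<exists>h\<in>borel_measurable lborel. density lborel h = interval_measure H"
    by (intro sigma_finite_measure.Radon_Nikodym sigma_finite_lborel) simp_all
  then obtain h where h[measurable]: "h \<in> borel_measurable borel"
    and dens: "density lborel h = interval_measure H" by auto
  have int_h: "(\<integral>\<^sup>+x. h x * indicator {a..b} x \<partial>lborel) = ennreal (H b - H a)" if "a \<le> b" for a b
  proof -
    have "(\<integral>\<^sup>+x. h x * indicator {a..b} x \<partial>lborel) = emeasure (density lborel h) {a..b}"
      by (subst emeasure_density) auto
    also have "\<dots> = ennreal (H b - H a)"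
      unfolding dens using that mono contH
      by (intro emeasure_interval_measure_Icc) (auto intro: continuous_on_subset)
    finally show ?thesis .
  qed
  have hi_H: "((\<lambda>x. enn2real (h x)) has_integral H b - H a) {a..b}" if ab: "a \<le> b" for a b
  proof -
    have "AE x in lborel. h x * indicator {a..b} x \<noteq> \<infinity>"
      by (rule nn_integral_PInf_AE) (auto simp: int_h[OF ab])
    then have "AE x in lborel. ennreal (if x \<in> {a..b} then enn2real (h x) else 0) = h x * indicator {a..b} x"
      by eventually_elim (auto simp: indicator_def less_top)
    then have "(\<integral>\<^sup>+x. ennreal (if x \<in> {a..b} then enn2real (h x) else 0) \<partial>lborel)
        = (\<integral>\<^sup>+x. h x * indicator {a..b} x \<partial>lborel)"
      by (rule nn_integral_cong_AE)
    then have "(\<integral>\<^sup>+x. ennreal (if x \<in> {a..b} then enn2real (h x) else 0) \<partial>lborel) = ennreal (H b - H a)"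
      using int_h[OF ab] by simp
    then have "((\<lambda>x. if x \<in> {a..b} then enn2real (h x) else 0) has_integral (H b - H a)) UNIV"
      using mono[OF ab] by (intro nn_integral_has_integral) auto
    then show ?thesis by (simp only: has_integral_restrict_UNIV)
  qed
  define g where "g x = enn2real (h x) - K" for x
  have hi: "(g has_integral F b - F a) {a..b}" if ab: "a \<le> b" for a b
  proof -
    have "((\<lambda>x. K) has_integral K * (b - a)) {a..b}"
      using has_integral_const_real[of K a b] ab by (simp add: mult.commute)
    from has_integral_diff[OF hi_H[OF ab] this] show ?thesis
      by (simp add: g_def[abs_def] H_def algebra_simps)
  qed
  have int1: "g integrable_on cbox a b" for a b
    using hi[of a b] by (cases "a \<le> b") (auto simp: cbox_interval intro: has_integral_integrable)
  have int2: "(\<lambda>x. g (- x)) integrable_on cbox a b" for a b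
    using int1[of "-b" "-a"] integrable_reflect[of g "-a" "-b"] by simp
  \<comment> \<open>The differentiation theorem that is used looks at the intervals \<open>{x..x + h}\<close> only, so it yields right
derivatives. Its application to the reflection of \<open>g\<close> yields left derivatives with the same value.\<close>
  obtain N1 where N1: "negligible N1"
    "\<And>x e. \<lbrakk>x \<notin> N1; 0 < e\<rbrakk> \<Longrightarrow> \<exists>d>0. \<forall>h. 0 < h \<and> h < d \<longrightarrow>
         norm (integral (cbox x (x + h *\<^sub>R One)) g /\<^sub>R h ^ DIM(real) - g x) < e"
    using integrable_ccontinuous_explicit[OF int1] by metis
  obtain N2 where N2: "negligible N2"
    "\<And>x e. \<lbrakk>x \<notin> N2; 0 < e\<rbrakk> \<Longrightarrow> \<exists>d>0. \<forall>h. 0 < h \<and> h < d \<longrightarrow>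
         norm (integral (cbox x (x + h *\<^sub>R One)) (\<lambda>x. g (-x)) /\<^sub>R h ^ DIM(real) - g (-x)) < e"
    using integrable_ccontinuous_explicit[OF int2] by metis
  have right: "integral (cbox x (x + h *\<^sub>R One)) g = F (x + h) - F x" if "0 < h" for x h
    using hi[of x "x+h"] that by (simp add: cbox_interval integral_unique)
  have left: "integral (cbox x (x + h *\<^sub>R One)) (\<lambda>x. g (-x)) = F (-x) - F (-x - h)" if "0 < h" for x h
  proof -
    have "(g has_integral F (-x) - F (-x - h)) {-x - h..-x}" using hi that by simp
    from has_integral_reflect_lemma_real[OF this] show ?thesis
      by (simp add: integral_unique add.commute)
  qed
  define N where "N = N1 \<union> uminus ` N2"
  have deriv: "(F has_real_derivative g x) (at x)" if "x \<notin> N" for x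
    unfolding DERIV_def LIM_eq
  proof (intro allI impI)
    fix e :: real assume e: "0 < e"
    have x1: "x \<notin> N1" and x2: "- x \<notin> N2"
      using that image_eqI[of x uminus "-x" N2] unfolding N_def by auto
    obtain d1 where d1: "d1 > 0" "\<And>h. 0 < h \<Longrightarrow> h < d1 \<Longrightarrow> \<bar>(F (x + h) - F x) / h - g x\<bar> < e"
    proof -
      obtain d where "d > 0" and d: "\<And>h. 0 < h \<and> h < d \<Longrightarrow> norm (integral (cbox x (x + h *\<^sub>R One)) g /\<^sub>R h ^ DIM(real) - g x) < e"
        using N1(2)[OF x1 e] by metis
      moreover have "\<bar>(F (x + h) - F x) / h - g x\<bar> < e" if "0 < h" "h < d" for h
        using d[of h] that unfolding right[OF that(1)] by (simp add: divide_inverse_commute)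
      ultimately show thesis using that by blast
    qed
    obtain d2 where d2: "d2 > 0" "\<And>h. 0 < h \<Longrightarrow> h < d2 \<Longrightarrow> \<bar>(F x - F (x - h)) / h - g x\<bar> < e"
    proof -
      obtain d where "d > 0" and d: "\<And>h. 0 < h \<and> h < d \<Longrightarrow> norm (integral (cbox (-x) (-x + h *\<^sub>R One)) (\<lambda>x. g (-x)) /\<^sub>R h ^ DIM(real) - g (- (-x))) < e"
        using N2(2)[OF x2 e] by metis
      moreover have "\<bar>(F x - F (x - h)) / h - g x\<bar> < e" if "0 < h" "h < d" for h
        using d[of h] that unfolding left[OF that(1)] by (simp add: divide_inverse_commute)
      ultimately show thesis using that by blast
    qed
    show "\<exists>s>0. \<forall>h. h \<noteq> 0 \<and> norm (h - 0) < s \<longrightarrow> norm ((F (x + h) - F x) / h - g x) < e"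
    proof (intro exI[of _ "min d1 d2"] conjI allI impI)
      fix h :: real assume h: "h \<noteq> 0 \<and> norm (h - 0) < min d1 d2"
      show "norm ((F (x + h) - F x) / h - g x) < e"
      proof (cases "h > 0")
        case True then show ?thesis using d1(2)[of h] h by simp
      next
        case False
        then have "(F x - F (x - (-h))) / (-h) = (F (x + h) - F x) / h" using h by (simp add: field_simps)
        then show ?thesis using d2(2)[of "-h"] h False by simp
      qed
    qed (use d1 d2 in auto)
  qed
  have "negligible N"
    unfolding N_def using N1(1) N2(1) 
    by (intro negligible_Un negligible_differentiable_image_negligible differentiable_on_minus differentiable_on_ident) auto
  then show thesis using hi deriv that by blast
qed

text \<open>This is the fundamental theorem of calculus that holds along trajectories: a Lyapunov inequality is
available there only at almost every time, and Lipschitz continuity keeps the remaining null set of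
times from contributing.\<close>

lemma lipschitz_AE_deriv_le_imp_le:
  fixes F :: "real \<Rightarrow> real"
  assumes "a \<le> b" and lip: "K-lipschitz_on {a..b} F" and "negligible N"
    and deriv: "\<And>x. x \<in> {a<..<b} - N \<Longrightarrow> \<exists>D. (F has_real_derivative D) (at x) \<and> D \<le> c"
  shows "F b - F a \<le> c * (b - a)"
proof -
  \<comment> \<open>Clamping the argument extends \<open>F\<close> from the interval to the line with the same Lipschitz constant.\<close>
  define F' where "F' x = F (max a (min b x))" for x
  have "K-lipschitz_on UNIV F'"
  proof (rule lipschitz_onI)
    fix x y
    have "dist (F' x) (F' y) \<le> K * dist (max a (min b x)) (max a (min b y))"
      unfolding F'_def using \<open>a \<le> b\<close> by (intro lipschitz_onD[OF lip]) auto
    also have "\<dots> \<le> K * dist x y"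
      using lipschitz_on_nonneg[OF lip] by (intro mult_left_mono) (auto simp: dist_real_def)
    finally show "dist (F' x) (F' y) \<le> K * dist x y" .
  qed (use lip lipschitz_on_nonneg in blast)
  then obtain g N' where g: "negligible N'" "\<And>a b. a \<le> b \<Longrightarrow> (g has_integral F' b - F' a) {a..b}"
    "\<And>x. x \<notin> N' \<Longrightarrow> (F' has_real_derivative g x) (at x)"
    using lipschitz_real_integral_of_derivative by metis
  have le: "g x \<le> c" if x: "x \<in> {a<..<b} - (N \<union> N')" for x
  proof -
    obtain D where D: "(F has_real_derivative D) (at x)" "D \<le> c" using deriv x by auto
    have "(F' has_real_derivative D) (at x)"
      using D(1) x by (rule_tac has_field_derivative_transform_within_open[of F D x "{a<..<b}"]) (auto simp: F'_def)
    then have "g x = D" using g(3)[of x] x DERIV_unique by blast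
    with D(2) show ?thesis by simp
  qed
  have "(g has_integral F b - F a) {a..b}" using g(2)[OF \<open>a \<le> b\<close>] \<open>a \<le> b\<close> by (simp add: F'_def)
  then have "((\<lambda>x. if x \<in> {a,b} \<union> N \<union> N' then c else g x) has_integral F b - F a) {a..b}"
    by (rule has_integral_spike[where S = "{a,b} \<union> N \<union> N'", rotated 2])
      (use g(1) \<open>negligible N\<close> in auto)
  moreover have "((\<lambda>x. c) has_integral c * (b - a)) {a..b}"
    using has_integral_const_real[of c a b] \<open>a \<le> b\<close> by (simp add: mult.commute)
  ultimately show ?thesis
    by (rule has_integral_le) (use le in auto)
qed

section \<open>Porous sets and sets that are null on lines\<close>

text \<open>A one-sided form of the density theorem. Disjoint balls from a Vitali cover inside an open superset of
almost the same measure cover almost all of \<open>S\<close>, and \<open>S\<close> fills at most a fraction \<open>q\<close> of them; so the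
measure of \<open>S\<close> is at most \<open>q\<close> times itself.\<close>

lemma negligible_if_locally_not_full:
  fixes S :: "'a::euclidean_space set"
  assumes S: "S \<in> sets lebesgue" and q: "0 \<le> q" "q < 1"
    and dens: "\<And>x d. x \<in> S \<Longrightarrow> 0 < d \<Longrightarrow>
      \<exists>r. 0 < r \<and> r < d \<and> measure lebesgue (S \<inter> ball x r) \<le> q * measure lebesgue (ball x r)"
  shows "negligible S"
proof -
  \<comment> \<open>The bound on \<open>S\<close> makes the measure of the set finite, as the final cancellation requires.\<close>
  have bounded_case: "negligible T" if T: "T = S \<inter> ball 0 R" for T R
  proof -
    have Tm: "T \<in> lmeasurable" unfolding T
      using S by (intro bounded_set_imp_lmeasurable) (auto intro: bounded_subset[OF bounded_ball])
    have densT: "measure lebesgue (T \<inter> ball x r) \<le> q * measure lebesgue (ball x r)"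
      if "measure lebesgue (S \<inter> ball x r) \<le> q * measure lebesgue (ball x r)" for x r
    proof -
      have "measure lebesgue (T \<inter> ball x r) \<le> measure lebesgue (S \<inter> ball x r)"
        unfolding T using S
        by (intro measure_mono_fmeasurable) (auto intro!: sets.Int fmeasurable_Int_fmeasurable simp: Int_commute[of S])
      with that show ?thesis by linarith
    qed
    have le: "measure lebesgue T \<le> q * (measure lebesgue T + e)" if "e > 0" for e
    proof -
      obtain W where W: "open W" "T \<subseteq> W" "W - T \<in> lmeasurable" "emeasure lebesgue (W - T) < ennreal e"
        using sets_lebesgue_outer_open[OF fmeasurableD[OF Tm] \<open>e > 0\<close>] by metis
      have Wm: "W \<in> lmeasurable"
        using fmeasurable.Un[OF Tm W(3)] W(2) by (simp add: Un_absorb1)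
      have "ennreal (measure lebesgue (W - T)) < ennreal e"
        using W(3,4) by (simp add: emeasure_eq_measure2)
      then have "measure lebesgue (W - T) < e" using ennreal_less_iff measure_nonneg by blast
      then have measW: "measure lebesgue W \<le> measure lebesgue T + e"
        using measurable_measure_Diff[OF Wm fmeasurableD[OF Tm] W(2)] by simp
      define I where "I = {(x, r). x \<in> T \<and> 0 < r \<and> ball x r \<subseteq> W \<and>
          measure lebesgue (T \<inter> ball x r) \<le> q * measure lebesgue (ball x r)}"
      have fine: "\<exists>i. i \<in> I \<and> x \<in> ball (fst i) (snd i) \<and> snd i < d" if "x \<in> T" "0 < d" for x d
      proof -
        obtain d' where d': "d' > 0" "ball x d' \<subseteq> W"
          using \<open>open W\<close> \<open>T \<subseteq> W\<close> \<open>x \<in> T\<close> by (meson openE subsetD)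
        have "x \<in> S" using \<open>x \<in> T\<close> T by simp
        obtain r where r: "0 < r" "r < min d d'" "measure lebesgue (S \<inter> ball x r) \<le> q * measure lebesgue (ball x r)"
          using dens[OF \<open>x \<in> S\<close>, of "min d d'"] \<open>0 < d\<close> d'(1) by auto
        have "ball x r \<subseteq> W" using d'(2) subset_ball[of r d' x] r(2) by simp
        then have "(x, r) \<in> I" using densT[OF r(3)] r(1) \<open>x \<in> T\<close> by (simp add: I_def)
        then show ?thesis using r by (intro exI[of _ "(x, r)"]) simp
      qed
      obtain C where C: "countable C" "C \<subseteq> I"
        "pairwise (\<lambda>i j. disjnt (ball (fst i) (snd i)) (ball (fst j) (snd j))) C"
        "negligible (T - (\<Union>i\<in>C. ball (fst i) (snd i)))"
        by (rule Vitali_covering_theorem_balls[of T I fst snd, OF fine])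
      have disj: "disjoint_family_on (\<lambda>i. ball (fst i) (snd i)) C"
        using C(3) by (simp add: disjoint_family_on_def pairwise_def disjnt_def)
      have subW: "(\<Union>i\<in>C. ball (fst i) (snd i)) \<subseteq> W"
        using C(2) by (fastforce simp: I_def)
      have "emeasure lebesgue T \<le> emeasure lebesgue ((\<Union>i\<in>C. T \<inter> ball (fst i) (snd i)) \<union> (T - (\<Union>i\<in>C. ball (fst i) (snd i))))"
        using Tm C(1,4) by (intro emeasure_mono sets.Un sets.countable_UN'' sets.Int)
           (auto simp: negligible_imp_sets fmeasurableD)
      also have "\<dots> = emeasure lebesgue (\<Union>i\<in>C. T \<inter> ball (fst i) (snd i))"
        using C(1,4) Tm by (intro emeasure_Un_null_set sets.countable_UN'' sets.Int)
          (auto simp: negligible_iff_null_sets fmeasurableD)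
      also have "\<dots> \<le> (\<integral>\<^sup>+i. emeasure lebesgue (T \<inter> ball (fst i) (snd i)) \<partial>count_space C)"
        using C(1) Tm by (intro emeasure_UN_countable_le sets.Int) (auto simp: fmeasurableD)
      also have "\<dots> \<le> (\<integral>\<^sup>+i. ennreal q * emeasure lebesgue (ball (fst i) (snd i)) \<partial>count_space C)"
      proof (rule nn_integral_mono)
        fix i assume "i \<in> space (count_space C)"
        then have "measure lebesgue (T \<inter> ball (fst i) (snd i)) \<le> q * measure lebesgue (ball (fst i) (snd i))"
          using C(2) by (auto simp: I_def)
        then show "emeasure lebesgue (T \<inter> ball (fst i) (snd i)) \<le> ennreal q * emeasure lebesgue (ball (fst i) (snd i))"
          using Tm q(1) emeasure_eq_measure2[OF fmeasurable_Int_fmeasurable[OF Tm, of "ball (fst i) (snd i)"]]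
            emeasure_eq_measure2[OF lmeasurable_ball[of "fst i" "snd i"]]
          by (simp flip: ennreal_mult add: ennreal_leI)
      qed
      also have "\<dots> = ennreal q * emeasure lebesgue (\<Union>i\<in>C. ball (fst i) (snd i))"
        using C(1) disj by (subst emeasure_UN_countable) (auto simp: nn_integral_cmult)
      also have "\<dots> \<le> ennreal q * emeasure lebesgue W"
        using subW Wm by (intro mult_left_mono emeasure_mono) auto
      also have "\<dots> = ennreal (q * measure lebesgue W)"
        using q(1) Wm by (simp add: emeasure_eq_measure2 ennreal_mult)
      finally have "measure lebesgue T \<le> q * measure lebesgue W"
        using Tm q(1) by (simp add: emeasure_eq_measure2)
      also have "\<dots> \<le> q * (measure lebesgue T + e)" using measW q(1) by (rule mult_left_mono)
      finally show ?thesis .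
    qed
    have "measure lebesgue T \<le> q * measure lebesgue T"
    proof (rule field_le_epsilon)
      fix e :: real assume "e > 0"
      have "measure lebesgue T \<le> q * measure lebesgue T + q * e"
        using le[OF \<open>e > 0\<close>] by (simp add: algebra_simps)
      also have "q * e \<le> e" using q \<open>e > 0\<close> by (simp add: mult_left_le_one_le)
      finally show "measure lebesgue T \<le> q * measure lebesgue T + e" by simp
    qed
    then have "(1 - q) * measure lebesgue T \<le> 0" by (simp add: algebra_simps)
    then have "measure lebesgue T = 0"
      using q(2) measure_nonneg[of lebesgue T] by (simp add: mult_le_0_iff)
    then show ?thesis using Tm by (simp add: negligible_iff_measure)
  qed
  have "S = (\<Union>n::nat. S \<inter> ball 0 (real n))"
    using reals_Archimedean2 by auto
  moreover have "negligible (\<Union>n::nat. S \<inter> ball 0 (real n))"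
    by (rule negligible_Union_nat) (rule bounded_case[OF refl])
  ultimately show ?thesis by simp
qed

text \<open>At a point where the conclusion fails for some \<open>\<eta>\<close>, arbitrarily small balls around the point contain a
hole of \<open>S\<close> of proportional radius. These points fill at most a fixed fraction of such balls, so they
form a null set by the previous lemma.\<close>

lemma closed_AE_nonporous:
  fixes S :: "'a::euclidean_space set"
  assumes "closed S"
  obtains N where "negligible N"
    "\<And>x \<eta>. x \<in> S - N \<Longrightarrow> 0 < \<eta> \<Longrightarrow> \<exists>d>0. \<forall>z. dist z x < d \<longrightarrow> (\<exists>w\<in>S. dist z w \<le> \<eta> * dist z x)"
proof (cases "S = {}")
  case False
  \<comment> \<open>The points \<open>x\<close> that see a hole of relative size \<open>\<eta>\<close> at a distance below \<open>1 / (n + 1)\<close>. As a union of open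
sets over the centres \<open>z\<close> it is open, which settles the measurability of the exceptional set.\<close>
  define P where "P \<eta> n = (\<Union>z. {x. dist z x < 1 / real (Suc n) \<and> \<eta> * dist z x < infdist z S})" for \<eta> and n :: nat
  define B where "B \<eta> = S \<inter> (\<Inter>n. P \<eta> n)" for \<eta>
  have openP: "open (P \<eta> n)" for \<eta> n
    unfolding P_def by (intro open_UN ballI open_Collect_conj open_Collect_less continuous_intros)
  have "negligible (B \<eta>)" if \<eta>: "0 < \<eta>" "\<eta> \<le> 1" for \<eta>
  proof (rule negligible_if_locally_not_full)
    have "B \<eta> \<in> sets borel" unfolding B_def using openP \<open>closed S\<close> by (intro sets.Int sets.countable_INT) auto
    then show "B \<eta> \<in> sets lebesgue" by (simp add: sets_completionI_sets)
    show "1 - (\<eta> / 2) ^ DIM('a) < 1" using \<eta> by simp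
    show "0 \<le> 1 - (\<eta> / 2) ^ DIM('a)" using \<eta> by (simp add: power_le_one)
    fix x d assume x: "x \<in> B \<eta>" and "0 < (d::real)"
    obtain n where n: "1 / real (Suc n) < d / 2" using \<open>0 < d\<close> by (meson half_gt_zero nat_approx_posE)
    from x obtain z where z: "dist z x < 1 / real (Suc n)" "\<eta> * dist z x < infdist z S" and "x \<in> S"
      unfolding B_def P_def by blast
    define r where "r = dist z x"
    have r: "0 < r" using z(2) \<open>x \<in> S\<close> by (cases "z = x") (auto simp: r_def)
    have empty: "S \<inter> ball z (\<eta> * r) = {}"
      using z(2) infdist_le[of _ S z] unfolding r_def by (force simp: dist_commute)
    have sub: "ball z (\<eta> * r) \<subseteq> ball x (2 * r)"
    proof
      fix w assume "w \<in> ball z (\<eta> * r)"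
      then have "dist z w < \<eta> * r" by simp
      also have "\<eta> * r \<le> 1 * r" using \<eta> r by (intro mult_right_mono) auto
      finally show "w \<in> ball x (2 * r)"
        using dist_triangle[of x w z] by (simp add: r_def dist_commute)
    qed
    have "measure lebesgue (B \<eta> \<inter> ball x (2 * r)) \<le> measure lebesgue (ball x (2 * r) - ball z (\<eta> * r))"
    proof (rule measure_mono_fmeasurable)
      show "B \<eta> \<inter> ball x (2 * r) \<subseteq> ball x (2 * r) - ball z (\<eta> * r)" using empty by (auto simp: B_def)
      show "B \<eta> \<inter> ball x (2 * r) \<in> sets lebesgue" using \<open>B \<eta> \<in> sets lebesgue\<close> by auto
    qed (auto intro!: fmeasurable_Diff)
    also have "\<dots> = measure lebesgue (ball x (2 * r)) - measure lebesgue (ball z (\<eta> * r))"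
      using sub by (intro measurable_measure_Diff) auto
    also have "\<dots> = (1 - (\<eta> / 2) ^ DIM('a)) * measure lebesgue (ball x (2 * r))"
      using r \<eta> by (simp add: content_ball power_mult_distrib power_divide field_simps)
    finally show "\<exists>r. 0 < r \<and> r < d \<and> measure lebesgue (B \<eta> \<inter> ball x r) \<le> (1 - (\<eta> / 2) ^ DIM('a)) * measure lebesgue (ball x r)"
      using r z n by (intro exI[of _ "2 * r"]) (auto simp: r_def)
  qed
  then have "negligible (\<Union>k::nat. B (1 / real (Suc k)))"
    by (intro negligible_Union_nat) auto
  moreover have "\<exists>d>0. \<forall>z. dist z x < d \<longrightarrow> (\<exists>w\<in>S. dist z w \<le> \<eta> * dist z x)"
    if x: "x \<in> S - (\<Union>k::nat. B (1 / real (Suc k)))" and "0 < \<eta>" for x \<eta>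
  proof -
    obtain k where k: "1 / real (Suc k) < \<eta>" using \<open>0 < \<eta>\<close> by (meson nat_approx_posE)
    from x have "x \<notin> B (1 / real (Suc k))" "x \<in> S" by auto
    then obtain n where n: "x \<notin> P (1 / real (Suc k)) n" unfolding B_def by blast
    show ?thesis
    proof (intro exI[of _ "1 / real (Suc n)"] conjI allI impI)
      fix z assume "dist z x < 1 / real (Suc n)"
      with n have "infdist z S \<le> 1 / real (Suc k) * dist z x" unfolding P_def by force
      also have "\<dots> \<le> \<eta> * dist z x" using k by (intro mult_right_mono) auto
      finally have "infdist z S \<le> \<eta> * dist z x" .
      moreover obtain w where "w \<in> S" "infdist z S = dist z w"
        using infdist_attains_inf[OF \<open>closed S\<close> False] by metis
      ultimately show "\<exists>w\<in>S. dist z w \<le> \<eta> * dist z x" by auto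
    qed simp
  qed
  ultimately show thesis using that by blast
qed (use that[of "{}"] in auto)

text \<open>Translation invariance replaces a choice of coordinates: averaging the measure of the translates
\<open>N - t *\<^sub>R b\<close> over \<open>t\<close> does not change it, and exchanging the integrals leaves the lengths of the
intersections of \<open>N\<close> with lines in direction \<open>b\<close>.\<close>

lemma negligible_if_negligible_on_lines:
  fixes N :: "'a::euclidean_space set"
  assumes N: "N \<in> sets borel" and lines: "\<And>x. negligible {t::real. x + t *\<^sub>R b \<in> N}"
  shows "negligible N"
proof -
  have [measurable]: "N \<in> sets borel" by fact
  have "emeasure lborel N = (\<integral>\<^sup>+t. indicator {0..1::real} t * emeasure lborel N \<partial>lborel)"
    by (simp add: nn_integral_multc)
  also have "\<dots> = (\<integral>\<^sup>+t. (\<integral>\<^sup>+x. indicator {0..1::real} t * indicator N (x + t *\<^sub>R b) \<partial>lborel) \<partial>lborel)"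
  proof (rule nn_integral_cong)
    fix t :: real
    have "emeasure lborel N = (\<integral>\<^sup>+x. indicator N x \<partial>distr lborel borel ((+) (t *\<^sub>R b)))"
      by (simp add: lborel_distr_plus)
    also have "\<dots> = (\<integral>\<^sup>+x. indicator N (x + t *\<^sub>R b) \<partial>lborel)"
      by (subst nn_integral_distr) (auto simp: add.commute)
    finally show "indicator {0..1} t * emeasure lborel N
        = (\<integral>\<^sup>+x. indicator {0..1::real} t * indicator N (x + t *\<^sub>R b) \<partial>lborel)"
      by (subst nn_integral_cmult) simp_all
  qed
  also have "\<dots> = (\<integral>\<^sup>+x. (\<integral>\<^sup>+t. indicator {0..1::real} t * indicator N (x + t *\<^sub>R b) \<partial>lborel) \<partial>lborel)"
    by (rule lborel_pair.Fubini'[symmetric]) (simp add: case_prod_beta)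
  also have "\<dots> = 0"
  proof -
    have "(\<integral>\<^sup>+t. indicator {0..1::real} t * indicator N (x + t *\<^sub>R b) \<partial>lborel) = 0" for x
    proof -
      have "{t::real. x + t *\<^sub>R b \<in> N} \<in> null_sets lborel"
        using lines[of x] by (simp add: negligible_iff_null_sets null_sets_completion_iff)
      then have "AE t in lborel. t \<notin> {t::real. x + t *\<^sub>R b \<in> N}" by (rule AE_not_in)
      then have "AE t in lborel. indicator {0..1::real} t * indicator N (x + t *\<^sub>R b) = (0::ennreal)"
        by eventually_elim auto
      then show ?thesis by (subst nn_integral_0_iff_AE) auto
    qed
    then show ?thesis by simp
  qed
  finally have "N \<in> null_sets lborel" by auto
  then show ?thesis by (simp add: negligible_iff_null_sets null_sets_completionI)
qed

section \<open>Rademacher's theorem\<close>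

text \<open>The points near which the difference quotients of \<open>f\<close> in direction \<open>b\<close> differ from \<open>y\<close> by at most \<open>\<epsilon>\<close>,
for all steps below \<open>\<delta>\<close>. With the scale \<open>\<delta>\<close> and the slope \<open>y\<close> as parameters, the set is closed, and
countably many choices of them exhaust the points of differentiability in direction \<open>b\<close>.\<close>

definition almost_linear_along ::
    "('a::real_normed_vector \<Rightarrow> real) \<Rightarrow> real \<Rightarrow> real \<Rightarrow> 'a \<Rightarrow> real \<Rightarrow> 'a set" where
  "almost_linear_along f \<epsilon> \<delta> b y =
     {x. \<forall>t. \<bar>t\<bar> < \<delta> \<longrightarrow> \<bar>f (x + t *\<^sub>R b) - f x - t * y\<bar> \<le> \<epsilon> * \<bar>t\<bar>}"

lemma closed_almost_linear_along:
  assumes "continuous_on UNIV f"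
  shows "closed (almost_linear_along f \<epsilon> \<delta> b y)"
proof -
  have "almost_linear_along f \<epsilon> \<delta> b y =
      (\<Inter>t\<in>{t. \<bar>t\<bar> < \<delta>}. {x. \<bar>f (x + t *\<^sub>R b) - f x - t * y\<bar> \<le> \<epsilon> * \<bar>t\<bar>})"
    by (auto simp: almost_linear_along_def)
  moreover have "closed {x. \<bar>f (x + t *\<^sub>R b) - f x - t * y\<bar> \<le> \<epsilon> * \<bar>t\<bar>}" for t
    by (intro closed_Collect_le continuous_intros continuous_on_compose2[OF assms]) auto
  ultimately show ?thesis by auto
qed

lemma AE_almost_linear_along:
  fixes f :: "'a::euclidean_space \<Rightarrow> real"
  assumes lip: "L-lipschitz_on UNIV f" and "0 < \<epsilon>"
  shows "negligible (- (\<Union>y\<in>\<rat>. \<Union>m. almost_linear_along f \<epsilon> (1 / real (Suc m)) b y))"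
proof (rule negligible_if_negligible_on_lines[where b = b])
  let ?A = "\<lambda>m y. almost_linear_along f \<epsilon> (1 / real (Suc m)) b y"
  have cont: "continuous_on UNIV f" using lip by (rule lipschitz_on_continuous_on)
  show "- (\<Union>y\<in>\<rat>. \<Union>m. ?A m y) \<in> sets borel"
    using closed_almost_linear_along[OF cont] countable_rat
    by (intro borel_comp sets.countable_UN'' borel_closed) auto
  fix x
  have "(L * norm b)-lipschitz_on UNIV (\<lambda>t. f (x + t *\<^sub>R b))"
  proof (rule lipschitz_onI)
    fix s t
    have "dist (f (x + s *\<^sub>R b)) (f (x + t *\<^sub>R b)) \<le> L * dist (x + s *\<^sub>R b) (x + t *\<^sub>R b)"
      by (rule lipschitz_onD[OF lip]) auto
    also have "dist (x + s *\<^sub>R b) (x + t *\<^sub>R b) = norm b * dist s t"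
      by (simp add: dist_norm flip: scaleR_left_diff_distrib)
    finally show "dist (f (x + s *\<^sub>R b)) (f (x + t *\<^sub>R b)) \<le> L * norm b * dist s t" by (simp add: mult.assoc)
  qed (use lipschitz_on_nonneg[OF lip] in simp)
  then obtain g N where N: "negligible N"
    and deriv: "\<And>t. t \<notin> N \<Longrightarrow> ((\<lambda>t. f (x + t *\<^sub>R b)) has_real_derivative g t) (at t)"
    using lipschitz_real_integral_of_derivative by metis
  have "x + t *\<^sub>R b \<in> (\<Union>y\<in>\<rat>. \<Union>m. ?A m y)" if "t \<notin> N" for t
  proof -
    obtain y where y: "y \<in> \<rat>" "g t - \<epsilon> / 2 < y" "y < g t"
      using Rats_dense_in_real[of "g t - \<epsilon> / 2" "g t"] \<open>0 < \<epsilon>\<close> by auto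
    obtain s where s: "s > 0" "\<And>h. h \<noteq> 0 \<Longrightarrow> \<bar>h\<bar> < s \<Longrightarrow>
        \<bar>(f (x + (t + h) *\<^sub>R b) - f (x + t *\<^sub>R b)) / h - g t\<bar> < \<epsilon> / 2"
          proof -
      have "\<exists>s>0. \<forall>h. h \<noteq> 0 \<and> norm (h - 0) < s \<longrightarrow>
          norm ((f (x + (t + h) *\<^sub>R b) - f (x + t *\<^sub>R b)) / h - g t) < \<epsilon> / 2"
        using deriv[OF \<open>t \<notin> N\<close>] half_gt_zero[OF \<open>0 < \<epsilon>\<close>] unfolding DERIV_def LIM_eq by blast
      then show thesis using that by auto
    qed
    obtain m where m: "1 / real (Suc m) < s" using nat_approx_posE[OF s(1)] by blast
    have "x + t *\<^sub>R b \<in> ?A m y" unfolding almost_linear_along_def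
    proof (intro CollectI allI impI)
      fix h :: real assume h: "\<bar>h\<bar> < 1 / real (Suc m)"
      show "\<bar>f (x + t *\<^sub>R b + h *\<^sub>R b) - f (x + t *\<^sub>R b) - h * y\<bar> \<le> \<epsilon> * \<bar>h\<bar>"
      proof (cases "h = 0")
        case False
        define D where "D = f (x + (t + h) *\<^sub>R b) - f (x + t *\<^sub>R b)"
        have "\<bar>D / h - g t\<bar> < \<epsilon> / 2" unfolding D_def using s(2)[of h] h m False by linarith
        then have "\<bar>D / h - y\<bar> \<le> \<epsilon>" using y by linarith
        then have "\<bar>D / h - y\<bar> * \<bar>h\<bar> \<le> \<epsilon> * \<bar>h\<bar>" by (rule mult_right_mono) simp
        also have "\<bar>D / h - y\<bar> * \<bar>h\<bar> = \<bar>D - h * y\<bar>"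
          using False by (simp add: abs_mult[symmetric] algebra_simps)
        finally show ?thesis by (simp add: D_def algebra_simps)
      qed simp
    qed
    then show ?thesis using y(1) by blast
  qed
  then show "negligible {t. x + t *\<^sub>R b \<in> - (\<Union>y\<in>\<rat>. \<Union>m. ?A m y)}"
    by (intro negligible_subset[OF N]) auto
qed

text \<open>The increment from \<open>x\<close> to \<open>x + h\<close> is walked coordinate by coordinate. The corners of this walk need
not belong to \<open>S\<close>, but near a point where \<open>S\<close> has no large holes each corner is so close to \<open>S\<close>
that, by the Lipschitz bound, the known slope applies to the next segment with a small error.\<close>

lemma almost_linear_at_nonporous_point:
  fixes f :: "'a::euclidean_space \<Rightarrow> real"
  assumes lip: "L-lipschitz_on UNIV f" and "0 < \<epsilon>" "0 < \<delta>"
    and S: "S \<subseteq> (\<Inter>b\<in>Basis. almost_linear_along f \<epsilon> \<delta> b (Y \<bullet> b))" and x: "x \<in> S"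
    and near: "\<And>\<eta>. 0 < \<eta> \<Longrightarrow> \<exists>d>0. \<forall>z. dist z x < d \<longrightarrow> (\<exists>w\<in>S. dist z w \<le> \<eta> * dist z x)"
  shows "\<exists>d>0. \<forall>h. norm h < d \<longrightarrow> \<bar>f (x + h) - f x - Y \<bullet> h\<bar> \<le> real DIM('a) * (2 * \<epsilon>) * norm h"
proof -
  have L: "0 \<le> L" using lip lipschitz_on_nonneg by blast
  \<comment> \<open>Moving both ends of a segment to a point of \<open>S\<close> costs \<open>2 * L * \<eta>\<close> times the length of \<open>h\<close>, and
the hole size \<open>\<eta>\<close> is chosen such that this is at most \<open>\<epsilon>\<close>.\<close>
  define \<eta> where "\<eta> = \<epsilon> / (2 * L + 1)"
  have \<eta>: "0 < \<eta>" "2 * L * \<eta> \<le> \<epsilon>" using L \<open>0 < \<epsilon>\<close> by (auto simp: \<eta>_def field_simps)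
  obtain d where d: "d > 0" "\<And>z. dist z x < d \<Longrightarrow> \<exists>w\<in>S. dist z w \<le> \<eta> * dist z x"
    using near[OF \<eta>(1)] by blast
  have "\<bar>f (x + h) - f x - Y \<bullet> h\<bar> \<le> real DIM('a) * (2 * \<epsilon>) * norm h" if h: "norm h < min d \<delta>" for h
  proof -
    define p where "p B = (\<Sum>b\<in>B. (h \<bullet> b) *\<^sub>R b)" for B
    have p_le: "norm (p B) \<le> norm h" if "B \<subseteq> Basis" for B
    proof -
      have "p B \<bullet> b = (if b \<in> B then h \<bullet> b else 0)" if "b \<in> Basis" for b
        using \<open>B \<subseteq> Basis\<close> that finite_subset[OF \<open>B \<subseteq> Basis\<close> finite_Basis]
        by (auto simp: p_def inner_sum_left inner_Basis subset_iff if_distrib sum.delta cong: if_cong sum.cong)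
      then show ?thesis by (intro norm_le_componentwise) auto
    qed
    have step: "\<bar>f (x + p B) - f x - Y \<bullet> p B\<bar> \<le> card B * (2 * \<epsilon> * norm h)"
      if "finite B" "B \<subseteq> Basis" for B
      using that
    proof (induction B)
      case (insert b B)
      define t where "t = h \<bullet> b"
      have t: "\<bar>t\<bar> \<le> norm h" using insert.prems by (simp add: t_def Basis_le_norm)
      have pB: "p (insert b B) = p B + t *\<^sub>R b" using insert.hyps by (simp add: p_def t_def add.commute)
      have "dist (x + p B) x < d" using p_le[of B] insert.prems h by (simp add: dist_norm)
      then obtain w where w: "w \<in> S" "dist (x + p B) w \<le> \<eta> * dist (x + p B) x" using d(2) by blast
      have "\<eta> * dist (x + p B) x \<le> \<eta> * norm h"
        using p_le[of B] insert.prems \<eta>(1) by (intro mult_left_mono) (auto simp: dist_norm)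
      with w(2) have dw: "dist (x + p B) w \<le> \<eta> * norm h" by linarith
      have "\<bar>f (w + t *\<^sub>R b) - f w - t * (Y \<bullet> b)\<bar> \<le> \<epsilon> * \<bar>t\<bar>"
        using S w(1) insert.prems t h unfolding almost_linear_along_def by auto
      also have "\<dots> \<le> \<epsilon> * norm h" using t \<open>0 < \<epsilon>\<close> by simp
      finally have 1: "\<bar>f (w + t *\<^sub>R b) - f w - t * (Y \<bullet> b)\<bar> \<le> \<epsilon> * norm h" .
      have lipw: "\<bar>f (u + v) - f (w + v)\<bar> \<le> L * dist u w" for u v
        using lipschitz_onD[OF lip, of "u + v" "w + v"] by (simp add: dist_real_def)
      have "L * dist (x + p B) w \<le> L * (\<eta> * norm h)" using dw L by (rule mult_left_mono)
      moreover have "2 * (L * (\<eta> * norm h)) \<le> \<epsilon> * norm h"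
        using mult_right_mono[OF \<eta>(2) norm_ge_zero[of h]] by (simp add: mult_ac)
      ultimately have "\<bar>f (x + p B + t *\<^sub>R b) - f (x + p B) - t * (Y \<bullet> b)\<bar> \<le> 2 * \<epsilon> * norm h"
        using 1 lipw[of "x + p B" "t *\<^sub>R b"] lipw[of "x + p B" 0] by simp
      moreover have "\<bar>f (x + p B) - f x - Y \<bullet> p B\<bar> \<le> card B * (2 * \<epsilon> * norm h)"
        using insert by auto
      moreover have "real (card (insert b B)) * (2 * \<epsilon> * norm h) = card B * (2 * \<epsilon> * norm h) + 2 * \<epsilon> * norm h"
        using insert.hyps by (simp add: algebra_simps)
      ultimately show ?case
        unfolding pB by (simp add: inner_add_right add.assoc[symmetric])
    qed (simp add: p_def)
    have "p Basis = h" by (simp add: p_def euclidean_representation)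
    with step[OF finite_Basis order_refl] show ?thesis by (simp add: mult.assoc)
  qed
  then show ?thesis using d(1) \<open>0 < \<delta>\<close> by (intro exI[of _ "min d \<delta>"]) simp
qed

text \<open>The linear approximations may depend on the accuracy. Two of them agree up to the sum of their
accuracies, so they converge, and the limit is the gradient.\<close>

lemma has_derivative_if_almost_linear:
  fixes f :: "'a::euclidean_space \<Rightarrow> real"
  assumes "\<And>\<epsilon>. 0 < \<epsilon> \<Longrightarrow> \<exists>Y. \<exists>d>0. \<forall>h. norm h < d \<longrightarrow> \<bar>f (x + h) - f x - Y \<bullet> h\<bar> \<le> \<epsilon> * norm h"
  shows "\<exists>g. (f has_derivative (\<lambda>h. g \<bullet> h)) (at x)"
proof -
  obtain Y d where d: "\<And>\<epsilon>. 0 < \<epsilon> \<Longrightarrow> 0 < d \<epsilon>"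
    and Y: "\<And>\<epsilon> h. 0 < \<epsilon> \<Longrightarrow> norm h < d \<epsilon> \<Longrightarrow> \<bar>f (x + h) - f x - Y \<epsilon> \<bullet> h\<bar> \<le> \<epsilon> * norm h"
    using assms by metis
  have close: "norm (Y a - Y b) \<le> a + b" if "0 < a" "0 < b" for a b
  proof (cases "Y a = Y b")
    case False
    define v where "v = Y a - Y b"
    have v: "norm v > 0" using False by (simp add: v_def)
    define h where "h = (min (d a) (d b) / 2 / norm v) *\<^sub>R v"
    have nh: "norm h = min (d a) (d b) / 2" using v d[OF that(1)] d[OF that(2)] by (simp add: h_def)
    then have "norm h < d a" "norm h < d b" "norm h > 0" using d[OF that(1)] d[OF that(2)] nh by linarith+
    then have "\<bar>Y a \<bullet> h - Y b \<bullet> h\<bar> \<le> a * norm h + b * norm h"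
      using Y[of a h] Y[of b h] that by linarith
    moreover have "Y a \<bullet> h - Y b \<bullet> h = norm v * norm h"
    proof -
      have "Y a \<bullet> h - Y b \<bullet> h = v \<bullet> h" by (simp add: v_def inner_diff_left)
      also have "\<dots> = (min (d a) (d b) / 2 / norm v) * (norm v * norm v)"
        unfolding h_def by (simp add: dot_square_norm power2_eq_square)
      finally show ?thesis using v by (simp add: nh)
    qed
    ultimately have "norm v * norm h \<le> (a + b) * norm h" by (simp add: algebra_simps)
    then show ?thesis using \<open>norm h > 0\<close> by (simp add: v_def)
  qed (use that in simp)
  have "Cauchy (\<lambda>n. Y (1 / real (Suc n)))"
  proof (rule metric_CauchyI)
    fix e :: real assume "0 < e"
    then obtain M where M: "1 / real (Suc M) < e / 2" by (meson half_gt_zero nat_approx_posE)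
    have small: "1 / real (Suc n) < e / 2" if "n \<ge> M" for n
    proof -
      have "1 / real (Suc n) \<le> 1 / real (Suc M)" using that by (simp add: frac_le)
      with M show ?thesis by linarith
    qed
    show "\<exists>M. \<forall>m\<ge>M. \<forall>n\<ge>M. dist (Y (1 / real (Suc m))) (Y (1 / real (Suc n))) < e"
    proof (intro exI allI impI)
      fix m n assume "M \<le> m" "M \<le> n"
      have "norm (Y (1 / real (Suc m)) - Y (1 / real (Suc n))) \<le> 1 / real (Suc m) + 1 / real (Suc n)"
        by (rule close) simp_all
      then show "dist (Y (1 / real (Suc m))) (Y (1 / real (Suc n))) < e"
        using small[OF \<open>M \<le> m\<close>] small[OF \<open>M \<le> n\<close>] unfolding dist_norm by linarith
    qed
  qed
  then obtain g where g: "(\<lambda>n. Y (1 / real (Suc n))) \<longlonglongrightarrow> g"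
    using Cauchy_convergent_iff convergent_def by blast
  have close_g: "norm (Y a - g) \<le> a" if "0 < a" for a
  proof (rule LIMSEQ_le)
    show "(\<lambda>n. norm (Y a - Y (1 / real (Suc n)))) \<longlonglongrightarrow> norm (Y a - g)"
      by (intro tendsto_intros g)
    have "(\<lambda>n. a + 1 / real (Suc n)) \<longlonglongrightarrow> a + 0"
      by (intro tendsto_intros LIMSEQ_Suc[OF lim_1_over_n])
    then show "(\<lambda>n. a + 1 / real (Suc n)) \<longlonglongrightarrow> a" by simp
    show "\<exists>N. \<forall>n\<ge>N. norm (Y a - Y (1 / real (Suc n))) \<le> a + 1 / real (Suc n)"
      using close that by simp
  qed
  have "(f has_derivative (\<lambda>h. g \<bullet> h)) (at x)"
    unfolding has_derivative_at_alt
  proof (intro conjI allI impI)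
    show "bounded_linear (\<lambda>h. g \<bullet> h)" by (rule bounded_linear_inner_right)
    fix e :: real assume "0 < e"
    define a where "a = e / 2"
    have a: "0 < a" using \<open>0 < e\<close> by (simp add: a_def)
    show "\<exists>d>0. \<forall>y. norm (y - x) < d \<longrightarrow> norm (f y - f x - g \<bullet> (y - x)) \<le> e * norm (y - x)"
    proof (intro exI[of _ "d a"] conjI allI impI)
      fix y assume "norm (y - x) < d a"
      then have 1: "\<bar>f y - f x - Y a \<bullet> (y - x)\<bar> \<le> a * norm (y - x)" using Y[OF a, of "y - x"] by simp
      have "\<bar>(Y a - g) \<bullet> (y - x)\<bar> \<le> norm (Y a - g) * norm (y - x)" by (rule Cauchy_Schwarz_ineq2)
      also have "\<dots> \<le> a * norm (y - x)" using close_g[OF a] by (intro mult_right_mono) auto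
      finally have 2: "\<bar>(Y a - g) \<bullet> (y - x)\<bar> \<le> a * norm (y - x)" .
      have "f y - f x - g \<bullet> (y - x) = (f y - f x - Y a \<bullet> (y - x)) + (Y a - g) \<bullet> (y - x)"
        by (simp add: inner_diff_left)
      moreover have "e * norm (y - x) = a * norm (y - x) + a * norm (y - x)" by (simp add: a_def)
      ultimately show "norm (f y - f x - g \<bullet> (y - x)) \<le> e * norm (y - x)" using 1 2 unfolding real_norm_def by linarith
    qed (rule d[OF a])
  qed
  then show ?thesis by (rule exI)
qed

text \<open>Along lines in coordinate directions the function is differentiable almost everywhere. Sorting the
points by rational slopes and scales gives countably many closed sets, and almost every point of such
a set is one where the set is not porous. There the partial derivatives combine to a gradient.\<close>

theorem Rademacher:
  fixes f :: "'a::euclidean_space \<Rightarrow> real"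
  assumes lip: "L-lipschitz_on UNIV f"
  obtains N where "negligible N"
    "\<And>x. x \<notin> N \<Longrightarrow> \<exists>g. (f has_derivative (\<lambda>h. g \<bullet> h)) (at x)"
proof -
  have cont: "continuous_on UNIV f" using lip by (rule lipschitz_on_continuous_on)
  define e where "e n = 1 / real (Suc n)" for n
  have e: "0 < e n" for n by (simp add: e_def)
  define A where "A n m y = (\<Inter>b\<in>Basis. almost_linear_along f (e n) (e m) b (y b))" for n m and y :: "'a \<Rightarrow> real"
  define Q :: "('a \<Rightarrow> real) set" where "Q = Basis \<rightarrow>\<^sub>E \<rat>"
  have Q: "countable Q" unfolding Q_def by (intro countable_PiE finite_Basis countable_rat)
  have closedA: "closed (A n m y)" for n m y
    unfolding A_def using closed_almost_linear_along[OF cont] by auto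
  have "\<exists>N. negligible N \<and> (\<forall>x \<eta>. x \<in> A n m y - N \<longrightarrow> 0 < \<eta> \<longrightarrow>
      (\<exists>d>0. \<forall>z. dist z x < d \<longrightarrow> (\<exists>w\<in>A n m y. dist z w \<le> \<eta> * dist z x)))" for n m y
    by (rule closed_AE_nonporous[OF closedA[of n m y]]) blast
  then obtain N1 where N1: "\<And>n m y. negligible (N1 n m y)"
    and near: "\<And>n m y x \<eta>. x \<in> A n m y - N1 n m y \<Longrightarrow> 0 < \<eta> \<Longrightarrow>
      \<exists>d>0. \<forall>z. dist z x < d \<longrightarrow> (\<exists>w\<in>A n m y. dist z w \<le> \<eta> * dist z x)" by metis
  define N2 where "N2 n b = - (\<Union>y\<in>\<rat>. \<Union>m. almost_linear_along f (e n) (1 / real (Suc m)) b y)" for n and b :: 'a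
  define N where "N = (\<Union>n. \<Union>m. \<Union>y\<in>Q. N1 n m y) \<union> (\<Union>n. \<Union>b\<in>Basis. N2 n b)"
  have "negligible N"
  proof -
    have "negligible (N2 n b)" for n b unfolding N2_def by (rule AE_almost_linear_along[OF lip e])
    then show ?thesis unfolding N_def
      by (intro negligible_Un negligible_Union_nat negligible_countable_Union countable_image Q)
        (auto simp: N1 countable_finite)
  qed
  moreover have "\<exists>g. (f has_derivative (\<lambda>h. g \<bullet> h)) (at x)" if x: "x \<notin> N" for x
  proof -
    have "\<exists>Y. \<exists>d>0. \<forall>h. norm h < d \<longrightarrow> \<bar>f (x + h) - f x - Y \<bullet> h\<bar> \<le> \<epsilon> * norm h" if "0 < \<epsilon>" for \<epsilon>
    proof -
      obtain n where n: "e n < \<epsilon> / (2 * DIM('a))"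
        unfolding e_def using nat_approx_posE[of "\<epsilon> / (2 * DIM('a))"] \<open>0 < \<epsilon>\<close> by auto
      have "\<exists>y m. y \<in> \<rat> \<and> x \<in> almost_linear_along f (e n) (e m) b y" if "b \<in> Basis" for b
      proof -
        have "x \<notin> N2 n b" using x that unfolding N_def by blast
        then show ?thesis unfolding N2_def e_def by blast
      qed
      then obtain y m where y: "\<And>b. b \<in> Basis \<Longrightarrow> y b \<in> \<rat>"
        and m: "\<And>b. b \<in> Basis \<Longrightarrow> x \<in> almost_linear_along f (e n) (e (m b)) b (y b)" by metis
      define m' where "m' = Max (m ` Basis)"
      define y' where "y' = restrict y Basis"
      define Y where "Y = (\<Sum>b\<in>Basis. y b *\<^sub>R b)"
      have Yb: "Y \<bullet> b = y' b" if "b \<in> Basis" for b using that by (simp add: Y_def y'_def)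
      have "y' \<in> Q" using y by (auto simp: Q_def y'_def)
      have "x \<in> almost_linear_along f (e n) (e m') b (y' b)" if b: "b \<in> Basis" for b
      proof -
        have "m b \<le> m'" unfolding m'_def using b by (intro Max_ge) auto
        then have "e m' \<le> e (m b)" by (simp add: e_def frac_le)
        then show ?thesis using m[OF b] b unfolding almost_linear_along_def y'_def by auto
      qed
      then have xA: "x \<in> A n m' y'" by (simp add: A_def)
      have sub: "A n m' y' \<subseteq> (\<Inter>b\<in>Basis. almost_linear_along f (e n) (e m') b (Y \<bullet> b))"
        by (auto simp: A_def Yb)
      have "x \<notin> N1 n m' y'" using x \<open>y' \<in> Q\<close> unfolding N_def by blast
      with xA have "x \<in> A n m' y' - N1 n m' y'" by blast
      note near' = near[OF this]
      have "\<exists>d>0. \<forall>h. norm h < d \<longrightarrow> \<bar>f (x + h) - f x - Y \<bullet> h\<bar> \<le> real DIM('a) * (2 * e n) * norm h"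
        using lip e e sub xA near' by (rule almost_linear_at_nonporous_point)
      moreover have "real DIM('a) * (2 * e n) \<le> \<epsilon>" using n by (simp add: field_simps)
      then have "real DIM('a) * (2 * e n) * norm h \<le> \<epsilon> * norm h" for h :: 'a by (rule mult_right_mono) simp
      ultimately show ?thesis by (meson order_trans)
    qed
    then show ?thesis by (rule has_derivative_if_almost_linear)
  qed
  ultimately show thesis using that by blast
qed

section \<open>Locally Lipschitz functions\<close>

text \<open>McShane's formula: the infimum of the cones \<open>f w + L * dist x w\<close> is the largest \<open>L\<close>-Lipschitz
extension.\<close>

lemma lipschitz_extension_real:
  fixes f :: "'a::metric_space \<Rightarrow> real"
  assumes lip: "L-lipschitz_on S f"
  obtains F where "L-lipschitz_on UNIV F" "\<And>x. x \<in> S \<Longrightarrow> F x = f x"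
proof (cases "S = {}")
  case True
  then show thesis using that[of "\<lambda>_. 0"] lipschitz_on_nonneg[OF lip] lipschitz_on_mono[OF lipschitz_on_constant] by blast
next
  case False
  have L: "0 \<le> L" using lip lipschitz_on_nonneg by blast
  have lipD: "\<bar>f x - f y\<bar> \<le> L * dist x y" if "x \<in> S" "y \<in> S" for x y
    using lipschitz_onD[OF lip that] by (simp add: dist_real_def)
  define F where "F x = (INF w\<in>S. f w + L * dist x w)" for x
  obtain w0 where w0: "w0 \<in> S" using False by blast
  have lb: "f w0 - L * dist x w0 \<le> f w + L * dist x w" if "w \<in> S" for w x
  proof -
    have "L * dist w0 w \<le> L * (dist x w0 + dist x w)"
      using L by (intro mult_left_mono) (metis dist_triangle dist_commute)
    then show ?thesis using lipD[OF w0 that] by (simp add: algebra_simps)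
  qed
  have bdd: "bdd_below ((\<lambda>w. f w + L * dist x w) ` S)" for x
    using lb by (intro bdd_belowI2)
  have F_le: "F x \<le> F y + L * dist x y" for x y
  proof -
    have "F x - L * dist x y \<le> F y" unfolding F_def[of y]
    proof (rule cINF_greatest[OF False])
      fix w assume w: "w \<in> S"
      have "F x \<le> f w + L * dist x w" unfolding F_def by (rule cINF_lower[OF bdd w])
      also have "L * dist x w \<le> L * (dist x y + dist y w)" using L by (intro mult_left_mono dist_triangle)
      finally show "F x - L * dist x y \<le> f w + L * dist y w" by (simp add: algebra_simps)
    qed
    then show ?thesis by simp
  qed
  have "L-lipschitz_on UNIV F"
  proof (rule lipschitz_onI)
    show "dist (F x) (F y) \<le> L * dist x y" for x y
      using F_le[of x y] F_le[of y x] by (simp add: dist_real_def dist_commute abs_le_iff)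
  qed (rule L)
  moreover have "F x = f x" if x: "x \<in> S" for x
  proof (rule antisym)
    show "F x \<le> f x" unfolding F_def using cINF_lower[OF bdd[of x] x] by simp
    show "f x \<le> F x" unfolding F_def
    proof (rule cINF_greatest[OF False])
      show "f x \<le> f w + L * dist x w" if "w \<in> S" for w using lipD[OF x that] by simp
    qed
  qed
  ultimately show thesis using that by blast
qed

lemma locally_lipschitz_on_subset:
  "locally_lipschitz_on S f \<Longrightarrow> T \<subseteq> S \<Longrightarrow> locally_lipschitz_on T f"
  unfolding locally_lipschitz_on_def by (meson Int_mono lipschitz_on_subset order_refl subsetD)

lemma locally_lipschitz_on_continuous_on:
  assumes "locally_lipschitz_on S f"
  shows "continuous_on S f"
  unfolding continuous_on_eq_continuous_within
proof
  fix x assume "x \<in> S"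
  with assms obtain r L where r: "r > 0" "L-lipschitz_on (ball x r \<inter> S) f"
    unfolding locally_lipschitz_on_def by blast
  then have "continuous (at x within (ball x r \<inter> S)) f"
    using \<open>x \<in> S\<close> by (intro lipschitz_on_continuous_within) auto
  then show "continuous (at x within S) f"
    using at_within_nhd[of x "ball x r" "S \<inter> ball x r" S] r(1) \<open>x \<in> S\<close>
    by (simp add: continuous_within Int_ac)
qed

lemma locally_lipschitz_on_compose:
  assumes f: "locally_lipschitz_on S f" and g: "locally_lipschitz_on T g" and im: "f ` S \<subseteq> T"
  shows "locally_lipschitz_on S (\<lambda>x. g (f x))"
  unfolding locally_lipschitz_on_def
proof
  fix x assume x: "x \<in> S"
  obtain r1 L1 where 1: "r1 > 0" "L1-lipschitz_on (ball x r1 \<inter> S) f"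
    using f x unfolding locally_lipschitz_on_def by blast
  obtain r2 L2 where 2: "r2 > 0" "L2-lipschitz_on (ball (f x) r2 \<inter> T) g"
    using g im x unfolding locally_lipschitz_on_def by blast
  obtain r3 where 3: "r3 > 0" "\<And>y. y \<in> S \<Longrightarrow> dist y x < r3 \<Longrightarrow> dist (f y) (f x) < r2"
    using locally_lipschitz_on_continuous_on[OF f] x 2(1) unfolding continuous_on_iff by blast
  have sub: "f ` (ball x (min r1 r3) \<inter> S) \<subseteq> ball (f x) r2 \<inter> T"
    using 3(2) im by (auto simp: dist_commute)
  have "(L2 * L1)-lipschitz_on (ball x (min r1 r3) \<inter> S) (\<lambda>x. g (f x))"
  proof (rule lipschitz_on_compose2[where f = f and g = g])
    show "L1-lipschitz_on (ball x (min r1 r3) \<inter> S) f" by (rule lipschitz_on_subset[OF 1(2)]) auto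
    show "L2-lipschitz_on (f ` (ball x (min r1 r3) \<inter> S)) g" by (rule lipschitz_on_subset[OF 2(2) sub])
  qed
  then show "\<exists>r>0. \<exists>L. L-lipschitz_on (ball x r \<inter> S) (\<lambda>x. g (f x))"
    using 1(1) 3(1) by (intro exI[of _ "min r1 r3"] conjI exI[of _ "L2 * L1"]) auto
qed

lemma locally_lipschitz_on_add:
  fixes f g :: "'a::metric_space \<Rightarrow> 'b::real_normed_vector"
  assumes f: "locally_lipschitz_on S f" and g: "locally_lipschitz_on S g"
  shows "locally_lipschitz_on S (\<lambda>x. f x + g x)"
  unfolding locally_lipschitz_on_def
proof
  fix x assume x: "x \<in> S"
  obtain r1 L1 where 1: "r1 > 0" "L1-lipschitz_on (ball x r1 \<inter> S) f"
    using f x unfolding locally_lipschitz_on_def by blast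
  obtain r2 L2 where 2: "r2 > 0" "L2-lipschitz_on (ball x r2 \<inter> S) g"
    using g x unfolding locally_lipschitz_on_def by blast
  have "(L1 + L2)-lipschitz_on (ball x (min r1 r2) \<inter> S) (\<lambda>x. f x + g x)"
    by (intro lipschitz_on_add lipschitz_on_subset[OF 1(2)] lipschitz_on_subset[OF 2(2)]) auto
  then show "\<exists>r>0. \<exists>L. L-lipschitz_on (ball x r \<inter> S) (\<lambda>x. f x + g x)"
    using 1(1) 2(1) by (intro exI[of _ "min r1 r2"] conjI exI[of _ "L1 + L2"]) auto
qed

lemma lipschitz_imp_locally_lipschitz_on:
  "L-lipschitz_on S f \<Longrightarrow> locally_lipschitz_on S f"
  unfolding locally_lipschitz_on_def by (meson Int_lower2 lipschitz_on_subset zero_less_one)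

text \<open>The points \<open>p\<close> and \<open>q\<close> need not lie in the compact set, only near a common point of it. This is what
makes a Lipschitz constant uniform along all orbits that start near a given one.\<close>

lemma locally_lipschitz_on_uniform:
  assumes f: "locally_lipschitz_on S f" and K: "compact K" "K \<subseteq> S"
  obtains \<delta> L where "0 < \<delta>" "0 \<le> L"
    "\<And>k p q. k \<in> K \<Longrightarrow> p \<in> S \<Longrightarrow> q \<in> S \<Longrightarrow> dist k p < \<delta> \<Longrightarrow> dist k q < \<delta> \<Longrightarrow>
       dist (f p) (f q) \<le> L * dist p q"
proof -
  have "\<forall>x\<in>K. \<exists>r>0. \<exists>L. L-lipschitz_on (ball x r \<inter> S) f"
    using f K(2) unfolding locally_lipschitz_on_def by blast
  then obtain r L where r: "\<And>x. x \<in> K \<Longrightarrow> 0 < r x"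
    and L: "\<And>x. x \<in> K \<Longrightarrow> (L x)-lipschitz_on (ball x (r x) \<inter> S) f" by metis
  obtain C where C: "C \<subseteq> K" "finite C" "K \<subseteq> (\<Union>x\<in>C. ball x (r x))"
    by (rule compactE_image[OF K(1), of K "\<lambda>x. ball x (r x)"]) (use r in auto)
  obtain \<delta> where \<delta>: "0 < \<delta>" "\<And>x. x \<in> K \<Longrightarrow> \<exists>G\<in>(\<lambda>x. ball x (r x)) ` C. ball x \<delta> \<subseteq> G"
    by (rule Heine_Borel_lemma[OF K(1) C(3)]) auto
  define M where "M = (\<Sum>x\<in>C. L x)"
  have Lnn: "0 \<le> L x" if "x \<in> C" for x using L that C(1) lipschitz_on_nonneg by blast
  have "dist (f p) (f q) \<le> M * dist p q"
    if kpq: "k \<in> K" "p \<in> S" "q \<in> S" "dist k p < \<delta>" "dist k q < \<delta>" for k p q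
  proof -
    obtain x where x: "x \<in> C" "ball k \<delta> \<subseteq> ball x (r x)" using \<delta>(2) kpq(1) by blast
    have "dist (f p) (f q) \<le> L x * dist p q"
      using kpq x C(1) by (intro lipschitz_onD[OF L[of x]]) (auto simp: subset_iff)
    also have "\<dots> \<le> M * dist p q"
      unfolding M_def using member_le_sum[of x C L] Lnn x C(2) by (intro mult_right_mono) auto
    finally show ?thesis .
  qed
  moreover have "0 \<le> M" unfolding M_def by (intro sum_nonneg Lnn)
  ultimately show thesis using that \<delta>(1) by blast
qed

lemma locally_lipschitz_on_compact_imp_lipschitz:
  assumes f: "locally_lipschitz_on K f" and K: "compact K"
  obtains L where "L-lipschitz_on K f"
proof -
  obtain \<delta> L where \<delta>: "0 < \<delta>" "0 \<le> L"
    "\<And>k p q. k \<in> K \<Longrightarrow> p \<in> K \<Longrightarrow> q \<in> K \<Longrightarrow> dist k p < \<delta> \<Longrightarrow> dist k q < \<delta> \<Longrightarrow>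
       dist (f p) (f q) \<le> L * dist p q"
    using locally_lipschitz_on_uniform[OF f K order_refl] by blast
  have "bounded (f ` K)"
    by (intro compact_imp_bounded compact_continuous_image locally_lipschitz_on_continuous_on f K)
  then have bnd: "dist (f p) (f q) \<le> diameter (f ` K)" if "p \<in> K" "q \<in> K" for p q
    using that by (intro diameter_bounded_bound) auto
  have diam: "0 \<le> diameter (f ` K)" using \<open>bounded (f ` K)\<close> by (rule diameter_ge_0)
  define M where "M = L + diameter (f ` K) / \<delta>"
  have "M-lipschitz_on K f"
  proof (rule lipschitz_onI)
    fix p q assume pq: "p \<in> K" "q \<in> K"
    show "dist (f p) (f q) \<le> M * dist p q"
    proof (cases "dist p q < \<delta>")
      case True
      then have "dist (f p) (f q) \<le> L * dist p q" using \<delta>(1) pq by (intro \<delta>(3)[of p]) auto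
      also have "\<dots> \<le> M * dist p q" using diam \<delta>(1) unfolding M_def by (intro mult_right_mono) auto
      finally show ?thesis .
    next
      case False
      have "dist (f p) (f q) \<le> diameter (f ` K) / \<delta> * \<delta>" using bnd[OF pq] \<delta>(1) by simp
      also have "\<dots> \<le> diameter (f ` K) / \<delta> * dist p q" using False \<delta>(1) diam by (intro mult_left_mono) auto
      also have "\<dots> \<le> M * dist p q" unfolding M_def using \<delta>(2) by (intro mult_right_mono) auto
      finally show ?thesis .
    qed
  qed (use \<delta> diam in \<open>simp add: M_def\<close>)
  then show thesis by (rule that)
qed

lemma C1_locally_lipschitz_on:
  fixes g :: "real \<Rightarrow> real"
  assumes "open S" and deriv: "\<And>y. y \<in> S \<Longrightarrow> (g has_real_derivative g' y) (at y)"
    and cont: "continuous_on S g'"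
  shows "locally_lipschitz_on S g"
  unfolding locally_lipschitz_on_def
proof
  fix y assume "y \<in> S"
  then obtain r where r: "r > 0" "cball y r \<subseteq> S" using \<open>open S\<close> open_contains_cball by metis
  have "bounded (g' ` cball y r)"
    by (intro compact_imp_bounded compact_continuous_image continuous_on_subset[OF cont r(2)] compact_cball)
  then have "\<exists>B>0. \<forall>w\<in>g' ` cball y r. norm w \<le> B" by (simp only: bounded_pos)
  then obtain B where "0 < B \<and> (\<forall>w\<in>g' ` cball y r. norm w \<le> B)" ..
  then have B: "0 < B" "\<forall>w\<in>g' ` cball y r. norm w \<le> B" by simp_all
  have "B-lipschitz_on (cball y r) g"
  proof (rule lipschitz_onI)
    fix u v assume uv: "u \<in> cball y r" "v \<in> cball y r"
    have "norm (g u - g v) \<le> B * norm (u - v)"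
    proof (rule field_differentiable_bound[of "cball y r" g g'])
      fix z assume z: "z \<in> cball y r"
      show "(g has_field_derivative g' z) (at z within cball y r)"
        using r(2) z by (intro has_field_derivative_at_within[OF deriv]) auto
      show "norm (g' z) \<le> B" using B(2) z by blast
    qed (use uv in simp_all)
    then show "dist (g u) (g v) \<le> B * dist u v" by (simp add: dist_norm)
  qed (use B in simp)
  then have "B-lipschitz_on (ball y r \<inter> S) g" by (rule lipschitz_on_subset) (simp add: le_infI1)
  with r(1) show "\<exists>r>0. \<exists>L. L-lipschitz_on (ball y r \<inter> S) g" by blast
qed

text \<open>Locally, the function coincides on \<open>S\<close> with a Lipschitz function on the whole space. The derivative of
this extension is a derivative within \<open>S\<close>, and a set is null if it is null locally.\<close>

lemma Rademacher_locally_lipschitz_on: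
  fixes f :: "'a::euclidean_space \<Rightarrow> real"
  assumes "locally_lipschitz_on S f"
  obtains N where "negligible N"
    "\<And>x. x \<in> S - N \<Longrightarrow> \<exists>g. (f has_derivative (\<lambda>h. g \<bullet> h)) (at x within S)"
proof -
  define N where "N = {x\<in>S. \<nexists>g. (f has_derivative (\<lambda>h. g \<bullet> h)) (at x within S)}"
  have "negligible N"
  proof (subst locally_negligible_alt, rule ballI)
    fix x assume "x \<in> N"
    then obtain r L where r: "r > 0" "L-lipschitz_on (ball x r \<inter> S) f"
      using assms unfolding N_def locally_lipschitz_on_def by blast
    obtain F where F: "L-lipschitz_on UNIV F" "\<And>y. y \<in> ball x r \<inter> S \<Longrightarrow> F y = f y"
      using lipschitz_extension_real[OF r(2)] by metis
    obtain N' where N': "negligible N'" "\<And>y. y \<notin> N' \<Longrightarrow> \<exists>g. (F has_derivative (\<lambda>h. g \<bullet> h)) (at y)"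
      using Rademacher[OF F(1)] by metis
    have "N \<inter> ball x r \<subseteq> N'"
    proof (rule subsetI, rule ccontr)
      fix y assume y: "y \<in> N \<inter> ball x r" "y \<notin> N'"
      then obtain g where "(F has_derivative (\<lambda>h. g \<bullet> h)) (at y)" using N'(2) by blast
      then have "(F has_derivative (\<lambda>h. g \<bullet> h)) (at y within S)" by (rule has_derivative_at_withinI)
      then have "(f has_derivative (\<lambda>h. g \<bullet> h)) (at y within S)"
      proof (rule has_derivative_transform_within)
        show "0 < r - dist x y" using y by auto
        fix z assume "z \<in> S" "dist z y < r - dist x y"
        then show "F z = f z" using dist_triangle[of x z y] by (intro F(2)) (auto simp: dist_commute)
      next
        show "y \<in> S" using y by (simp add: N_def)
      qed
      then show False using y by (auto simp: N_def)
    qed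
    then have "negligible (N \<inter> ball x r)" by (rule negligible_subset[OF N'(1)])
    then show "\<exists>U. openin (top_of_set N) U \<and> x \<in> U \<and> negligible U"
      using \<open>x \<in> N\<close> r(1) openin_open_Int[OF open_ball, of N x r]
      by (intro exI[of _ "N \<inter> ball x r"]) simp
  qed
  moreover have "\<exists>g. (f has_derivative (\<lambda>h. g \<bullet> h)) (at x within S)" if "x \<in> S - N" for x
    using that unfolding N_def by blast
  ultimately show thesis by (rule that)
qed

section \<open>Flows of locally Lipschitz vector fields\<close>

text \<open>The squared distance \<open>D\<close> changes at a rate of at most \<open>2 * L * D\<close> in either direction, so it becomes
monotone after multiplication by \<open>exp (- 2 * L * t)\<close> or \<open>exp (2 * L * t)\<close>. The second bound controls
initial values by later values; it stands in for a flow backwards in time, which need not exist.\<close>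

lemma two_sided_gronwall:
  fixes u v :: "real \<Rightarrow> 'a::real_inner"
  assumes du: "\<And>s. s \<in> {0..t} \<Longrightarrow> (u has_vector_derivative u' s) (at s within {0..})"
    and dv: "\<And>s. s \<in> {0..t} \<Longrightarrow> (v has_vector_derivative v' s) (at s within {0..})"
    and le: "\<And>s. s \<in> {0..t} \<Longrightarrow> norm (u' s - v' s) \<le> L * norm (u s - v s)"
    and "0 \<le> t"
  shows "norm (u t - v t) \<le> exp (L * t) * norm (u 0 - v 0)"
    and "norm (u 0 - v 0) \<le> exp (L * t) * norm (u t - v t)"
proof -
  define D where "D s = (u s - v s) \<bullet> (u s - v s)" for s
  have D: "D s = (norm (u s - v s))\<^sup>2" for s by (simp add: D_def dot_square_norm)
  define D' where "D' s = 2 * ((u s - v s) \<bullet> (u' s - v' s))" for s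
  have DD: "(D has_real_derivative D' s) (at s within {0..})" if "s \<in> {0..t}" for s
    unfolding D_def D'_def
    using du[OF that] dv[OF that] unfolding has_vector_derivative_def has_field_derivative_def
    by (auto intro!: derivative_eq_intros ext simp: inner_commute algebra_simps)
  have bound: "\<bar>D' s\<bar> \<le> 2 * L * D s" if "s \<in> {0..t}" for s
  proof -
    have "\<bar>(u s - v s) \<bullet> (u' s - v' s)\<bar> \<le> norm (u s - v s) * norm (u' s - v' s)" by (rule Cauchy_Schwarz_ineq2)
    also have "\<dots> \<le> norm (u s - v s) * (L * norm (u s - v s))" using le[OF that] by (rule mult_left_mono) simp
    finally show ?thesis by (simp add: D D'_def power2_eq_square mult_ac)
  qed
  have contD: "continuous_on {0..t} D" unfolding continuous_on_eq_continuous_within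
    using DD DERIV_continuous continuous_within_subset[of _ "{0..}" D "{0..t}"] by fastforce
  have deriv: "((\<lambda>s. exp (c * s) * D s) has_real_derivative exp (c * s) * (c * D s + D' s)) (at s)"
    if s: "0 < s" "s < t" for c s
  proof -
    have "(D has_real_derivative D' s) (at s)"
      using DD[of s] at_within_interior[of s "{0..}"] s by simp
    then show ?thesis by (auto intro!: derivative_eq_intros simp: algebra_simps)
  qed
  have "exp (- (2 * L) * t) * D t \<le> exp (- (2 * L) * 0) * D 0"
  proof (rule DERIV_nonpos_imp_decreasing_open[of 0 t "\<lambda>s. exp (- (2 * L) * s) * D s"])
    fix s assume s: "0 < s" "s < t"
    have "exp (- (2 * L) * s) * (- (2 * L) * D s + D' s) \<le> 0"
      using bound[of s] s by (simp add: mult_le_0_iff abs_le_iff)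
    with deriv[OF s] show "\<exists>y. ((\<lambda>s. exp (- (2 * L) * s) * D s) has_real_derivative y) (at s) \<and> y \<le> 0" by blast
  qed (use \<open>0 \<le> t\<close> in \<open>auto intro!: continuous_intros contD\<close>)
  then have "D t \<le> exp (2 * L * t) * D 0" by (simp add: exp_minus field_simps)
  then have "(norm (u t - v t))\<^sup>2 \<le> (exp (L * t) * norm (u 0 - v 0))\<^sup>2"
    by (simp add: D power_mult_distrib mult_ac flip: exp_double)
  then show "norm (u t - v t) \<le> exp (L * t) * norm (u 0 - v 0)" by (rule power2_le_imp_le) simp
  have "exp (2 * L * 0) * D 0 \<le> exp (2 * L * t) * D t"
  proof (rule DERIV_nonneg_imp_increasing_open[of 0 t "\<lambda>s. exp (2 * L * s) * D s"])
    fix s assume s: "0 < s" "s < t"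
    have "- D' s \<le> 2 * L * D s" using bound[of s] s by (simp add: abs_le_iff)
    then have "0 \<le> exp (2 * L * s) * (2 * L * D s + D' s)" by simp
    with deriv[OF s] show "\<exists>y. ((\<lambda>s. exp (2 * L * s) * D s) has_real_derivative y) (at s) \<and> 0 \<le> y" by blast
  qed (use \<open>0 \<le> t\<close> in \<open>auto intro!: continuous_intros contD\<close>)
  then have "(norm (u 0 - v 0))\<^sup>2 \<le> (exp (L * t) * norm (u t - v t))\<^sup>2"
    by (simp add: D power_mult_distrib mult_ac flip: exp_double)
  then show "norm (u 0 - v 0) \<le> exp (L * t) * norm (u t - v t)" by (rule power2_le_imp_le) simp
qed

lemma negligible_Times_UNIV:
  fixes E :: "'a::euclidean_space set"
  assumes "negligible E"
  shows "negligible (E \<times> (UNIV :: 'b::euclidean_space set))"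
proof -
  have "E \<in> null_sets (completion lborel)" using assms by (simp add: negligible_iff_null_sets)
  then obtain B where B: "B \<in> null_sets lborel" "E \<subseteq> B"
    using null_sets_completion_subset null_sets_completion_iff2 by metis
  have "B \<times> (UNIV :: 'b set) \<in> null_sets ((lborel :: 'a measure) \<Otimes>\<^sub>M (lborel :: 'b measure))"
    using B(1) by (intro lborel.times_in_null_sets1) auto
  then have "negligible (B \<times> (UNIV :: 'b set))"
    by (simp add: lborel_prod negligible_iff_null_sets null_sets_completionI)
  then show ?thesis by (rule negligible_subset) (use B(2) in auto)
qed

locale lipschitz_flow =
  fixes \<Omega> :: "'a::euclidean_space set" and f \<phi>
  assumes solution_map: "solution_map \<Omega> f \<phi>"
    and locally_lipschitz: "locally_lipschitz_on \<Omega> f"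
begin

lemma flow_0: "x \<in> \<Omega> \<Longrightarrow> \<phi> x 0 = x"
  and flow_in: "x \<in> \<Omega> \<Longrightarrow> 0 \<le> t \<Longrightarrow> \<phi> x t \<in> \<Omega>"
  and flow_deriv: "x \<in> \<Omega> \<Longrightarrow> 0 \<le> t \<Longrightarrow> (\<phi> x has_vector_derivative f (\<phi> x t)) (at t within {0..})"
  and flow_unique: "x \<in> \<Omega> \<Longrightarrow> ode_solution \<Omega> f x u \<Longrightarrow> 0 \<le> t \<Longrightarrow> u t = \<phi> x t"
  and flow_continuous: "continuous_on (\<Omega> \<times> {0..}) (\<lambda>(x, t). \<phi> x t)"
  and flow_add: "x \<in> \<Omega> \<Longrightarrow> 0 \<le> t \<Longrightarrow> 0 \<le> s \<Longrightarrow> \<phi> (\<phi> x t) s = \<phi> x (t + s)"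
  using solution_map unfolding solution_map_def ode_solution_def by blast+

lemma continuous_on_orbit:
  assumes "x \<in> \<Omega>"
  shows "continuous_on {0..} (\<phi> x)"
proof -
  have "continuous_on {0::real..} (\<lambda>t. (x, t))" by (rule continuous_on_Pair[OF continuous_on_const continuous_on_id])
  from continuous_on_compose2[OF flow_continuous this] assms show ?thesis by auto
qed

lemma compact_orbit: "x \<in> \<Omega> \<Longrightarrow> compact (\<phi> x ` {0..t})"
  by (intro compact_continuous_image continuous_on_subset[OF continuous_on_orbit]) auto

lemma flow_at_equilibrium:
  assumes "z \<in> \<Omega>" "f z = 0" "0 \<le> t"
  shows "\<phi> z t = z"
  using flow_unique[of z "\<lambda>_. z" t] assms by (simp add: ode_solution_def)

lemma flow_inj:
  assumes xy: "x \<in> \<Omega>" "y \<in> \<Omega>" and "0 \<le> t" and eq: "\<phi> x t = \<phi> y t"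
  shows "x = y"
proof -
  let ?K = "\<phi> x ` {0..t} \<union> \<phi> y ` {0..t}"
  have "?K \<subseteq> \<Omega>" using flow_in xy by auto
  then obtain L where L: "L-lipschitz_on ?K f"
    using locally_lipschitz_on_compact_imp_lipschitz[OF locally_lipschitz_on_subset[OF locally_lipschitz]]
      compact_Un[OF compact_orbit compact_orbit] xy by metis
  have "norm (\<phi> x 0 - \<phi> y 0) \<le> exp (L * t) * norm (\<phi> x t - \<phi> y t)"
  proof (rule two_sided_gronwall(2))
    show "norm (f (\<phi> x s) - f (\<phi> y s)) \<le> L * norm (\<phi> x s - \<phi> y s)" if "s \<in> {0..t}" for s
      using lipschitz_on_normD[OF L, of "\<phi> x s" "\<phi> y s"] that by auto
  qed (use flow_deriv xy \<open>0 \<le> t\<close> in auto)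
  then show ?thesis using eq xy by (simp add: flow_0)
qed

text \<open>All orbits that start near \<open>x0\<close> stay up to time \<open>T\<close> in a tube around the orbit of \<open>x0\<close> in which one
Lipschitz constant and one speed bound are valid.\<close>

lemma flow_bilipschitz:
  assumes x0: "x0 \<in> \<Omega>" and T: "0 \<le> T"
  obtains r C where "0 < r" "0 < C"
    "\<And>x y t. x \<in> ball x0 r \<inter> \<Omega> \<Longrightarrow> y \<in> ball x0 r \<inter> \<Omega> \<Longrightarrow> t \<in> {0..T} \<Longrightarrow>
      dist (\<phi> x t) (\<phi> y t) \<le> C * dist x y \<and> dist x y \<le> C * dist (\<phi> x t) (\<phi> y t)"
    "\<And>x s t. x \<in> ball x0 r \<inter> \<Omega> \<Longrightarrow> s \<in> {0..T} \<Longrightarrow> t \<in> {0..T} \<Longrightarrow> dist (\<phi> x s) (\<phi> x t) \<le> C * dist s t"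
proof -
  let ?K = "\<phi> x0 ` {0..T}"
  have K: "compact ?K" "?K \<subseteq> \<Omega>" using compact_orbit flow_in x0 by auto
  obtain \<delta> L where \<delta>: "0 < \<delta>" and L: "0 \<le> L"
    "\<And>k p q. k \<in> ?K \<Longrightarrow> p \<in> \<Omega> \<Longrightarrow> q \<in> \<Omega> \<Longrightarrow> dist k p < \<delta> \<Longrightarrow> dist k q < \<delta> \<Longrightarrow> dist (f p) (f q) \<le> L * dist p q"
    using locally_lipschitz_on_uniform[OF locally_lipschitz K] by metis
  obtain X0 where X0: "x0 \<in> X0" "open X0"
    "\<forall>x\<in>X0 \<inter> \<Omega>. \<forall>t\<in>{0..T}. dist ((\<lambda>(x, t). \<phi> x t) (x, t)) ((\<lambda>(x, t). \<phi> x t) (x0, t)) \<le> \<delta> / 2"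
    by (rule continuous_on_prod_compactE[of \<Omega> "{0..T}" "\<lambda>(x, t). \<phi> x t" x0 "\<delta> / 2"])
       (use x0 \<delta> in \<open>auto intro: continuous_on_subset[OF flow_continuous]\<close>)
  obtain r where r: "0 < r" "ball x0 r \<subseteq> X0" using X0(1,2) open_contains_ball by blast
  have tube: "dist (\<phi> x0 t) (\<phi> x t) < \<delta>" if "x \<in> ball x0 r \<inter> \<Omega>" "t \<in> {0..T}" for x t
  proof -
    have "dist (\<phi> x t) (\<phi> x0 t) \<le> \<delta> / 2" using X0(3) r(2) that by auto
    with \<delta> show ?thesis by (simp add: dist_commute)
  qed
  have "bounded (f ` ?K)"
    by (intro compact_imp_bounded compact_continuous_image K
        continuous_on_subset[OF locally_lipschitz_on_continuous_on[OF locally_lipschitz]])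
  then obtain B0 where B0: "\<forall>w\<in>f ` ?K. norm w \<le> B0" by (auto simp: bounded_iff)
  define B where "B = \<bar>B0\<bar> + L * \<delta>"
  have speed: "norm (f (\<phi> x t)) \<le> B" if x: "x \<in> ball x0 r \<inter> \<Omega>" and t: "t \<in> {0..T}" for x t
  proof -
    have "dist (f (\<phi> x0 t)) (f (\<phi> x t)) \<le> L * dist (\<phi> x0 t) (\<phi> x t)"
      using tube[OF x t] t x x0 flow_in \<delta> by (intro L(2)[of "\<phi> x0 t"]) auto
    also have "\<dots> \<le> L * \<delta>" using tube[OF x t] L(1) by (intro mult_left_mono) auto
    finally have "norm (f (\<phi> x t) - f (\<phi> x0 t)) \<le> L * \<delta>" by (simp add: dist_norm norm_minus_commute)
    moreover have "norm (f (\<phi> x0 t)) \<le> B0" using B0 t by blast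
    ultimately show ?thesis unfolding B_def using norm_triangle_sub[of "f (\<phi> x t)" "f (\<phi> x0 t)"] by linarith
  qed
  define C where "C = exp (L * T) + B"
  have B: "0 \<le> B" using L(1) \<delta> by (simp add: B_def)
  have expC: "exp (L * t) * c \<le> C * c" if "t \<in> {0..T}" "0 \<le> c" for t c
  proof (rule mult_right_mono)
    have "L * t \<le> L * T" using that L(1) by (intro mult_left_mono) auto
    then have "exp (L * t) \<le> exp (L * T)" by (simp only: exp_le_cancel_iff)
    then show "exp (L * t) \<le> C" using B unfolding C_def by linarith
  qed (rule that(2))
  show thesis
  proof (rule that[OF r(1), of C])
    show "0 < C" using B by (simp add: C_def add_pos_nonneg)
    fix x y t assume x: "x \<in> ball x0 r \<inter> \<Omega>" and y: "y \<in> ball x0 r \<inter> \<Omega>" and t: "t \<in> {0..T}"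
    have d: "norm (f (\<phi> x s) - f (\<phi> y s)) \<le> L * norm (\<phi> x s - \<phi> y s)" if "s \<in> {0..t}" for s
      using tube[OF x, of s] tube[OF y, of s] that t x y flow_in
      unfolding dist_norm[symmetric] by (intro L(2)[of "\<phi> x0 s"]) auto
    have "norm (\<phi> x t - \<phi> y t) \<le> exp (L * t) * norm (\<phi> x 0 - \<phi> y 0)"
      by (rule two_sided_gronwall(1)[OF _ _ d]) (use flow_deriv x y t in auto)
    moreover have "norm (\<phi> x 0 - \<phi> y 0) \<le> exp (L * t) * norm (\<phi> x t - \<phi> y t)"
      by (rule two_sided_gronwall(2)[OF _ _ d]) (use flow_deriv x y t in auto)
    ultimately show "dist (\<phi> x t) (\<phi> y t) \<le> C * dist x y \<and> dist x y \<le> C * dist (\<phi> x t) (\<phi> y t)"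
      using expC[OF t, of "dist x y"] expC[OF t, of "dist (\<phi> x t) (\<phi> y t)"] x y
      by (simp add: flow_0 dist_norm)
  next
    fix x s t assume x: "x \<in> ball x0 r \<inter> \<Omega>" and s: "s \<in> {0..T}" and t: "t \<in> {0..T}"
    have "norm (\<phi> x s - \<phi> x t) \<le> B * norm (s - t)"
    proof (rule differentiable_bound[of "{0..T}" "\<phi> x" "\<lambda>\<tau> h. h *\<^sub>R f (\<phi> x \<tau>)"])
      fix \<tau> assume \<tau>: "\<tau> \<in> {0..T}"
      have "(\<phi> x has_derivative (\<lambda>h. h *\<^sub>R f (\<phi> x \<tau>))) (at \<tau> within {0..})"
        using flow_deriv[of x \<tau>] x \<tau> by (simp add: has_vector_derivative_def)
      then show "(\<phi> x has_derivative (\<lambda>h. h *\<^sub>R f (\<phi> x \<tau>))) (at \<tau> within {0..T})"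
        by (rule has_derivative_subset) auto
      show "onorm (\<lambda>h. h *\<^sub>R f (\<phi> x \<tau>)) \<le> B"
        using speed[OF x \<tau>] by (intro onorm_le) (simp add: mult.commute[of _ "norm (f (\<phi> x \<tau>))"] mult_right_mono)
    qed (use s t in auto)
    also have "\<dots> \<le> C * norm (s - t)" by (rule mult_right_mono) (simp_all add: C_def)
    finally show "dist (\<phi> x s) (\<phi> x t) \<le> C * dist s t" by (simp add: dist_norm)
  qed
qed

lemma flow_locally_lipschitz: "locally_lipschitz_on (\<Omega> \<times> {0..}) (\<lambda>(x, t). \<phi> x t)"
  unfolding locally_lipschitz_on_def
proof
  fix z assume "z \<in> \<Omega> \<times> {0::real..}"
  then obtain x0 t0 where z: "z = (x0, t0)" "x0 \<in> \<Omega>" "0 \<le> t0" by auto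
  obtain r C where r: "0 < r" and C: "0 < C"
    "\<And>x y t. x \<in> ball x0 r \<inter> \<Omega> \<Longrightarrow> y \<in> ball x0 r \<inter> \<Omega> \<Longrightarrow> t \<in> {0..t0 + 1} \<Longrightarrow>
      dist (\<phi> x t) (\<phi> y t) \<le> C * dist x y \<and> dist x y \<le> C * dist (\<phi> x t) (\<phi> y t)"
    "\<And>x s t. x \<in> ball x0 r \<inter> \<Omega> \<Longrightarrow> s \<in> {0..t0 + 1} \<Longrightarrow> t \<in> {0..t0 + 1} \<Longrightarrow> dist (\<phi> x s) (\<phi> x t) \<le> C * dist s t"
    by (rule flow_bilipschitz[OF z(2), of "t0 + 1"]) (use z(3) in auto)
  have "(C + C)-lipschitz_on (ball z (min r 1) \<inter> (\<Omega> \<times> {0..})) (\<lambda>(x, t). \<phi> x t)"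
  proof (rule lipschitz_onI)
    fix p q assume p: "p \<in> ball z (min r 1) \<inter> (\<Omega> \<times> {0..})" and q: "q \<in> ball z (min r 1) \<inter> (\<Omega> \<times> {0..})"
    have in_box: "fst p \<in> ball x0 r \<inter> \<Omega> \<and> snd p \<in> {0..t0 + 1}" if "p \<in> ball z (min r 1) \<inter> (\<Omega> \<times> {0..})" for p
      using that dist_fst_le[of z p] dist_snd_le[of z p] z(1) by (auto simp: dist_real_def)
    have "dist (\<phi> (fst p) (snd p)) (\<phi> (fst q) (snd q))
        \<le> dist (\<phi> (fst p) (snd p)) (\<phi> (fst p) (snd q)) + dist (\<phi> (fst p) (snd q)) (\<phi> (fst q) (snd q))"
      by (rule dist_triangle)
    also have "\<dots> \<le> C * dist (snd p) (snd q) + C * dist (fst p) (fst q)"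
      using C(2)[of "fst p" "fst q" "snd q"] C(3)[of "fst p" "snd p" "snd q"] in_box[OF p] in_box[OF q]
      by (intro add_mono) auto
    also have "\<dots> \<le> C * dist p q + C * dist p q"
      using C(1) dist_fst_le[of p q] dist_snd_le[of p q] by (intro add_mono mult_left_mono) auto
    finally show "dist (case p of (x, t) \<Rightarrow> \<phi> x t) (case q of (x, t) \<Rightarrow> \<phi> x t) \<le> (C + C) * dist p q"
      by (simp add: case_prod_beta algebra_simps)
  qed (use C in simp)
  then show "\<exists>r>0. \<exists>L. L-lipschitz_on (ball z r \<inter> (\<Omega> \<times> {0..})) (\<lambda>(x, t). \<phi> x t)"
    using r by (intro exI[of _ "min r 1"] conjI exI[of _ "C + C"]) auto
qed

text \<open>The map \<open>(x, t) \<mapsto> (\<phi> x t, t)\<close> is injective and locally has a Lipschitz inverse, which maps the part of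
the null set \<open>E \<times> UNIV\<close> in its range back to a null set. With Fubini's theorem this says that almost
every orbit meets \<open>E\<close> for a null set of times only.\<close>

lemma negligible_flow_preimage:
  assumes E: "negligible E"
  shows "negligible {(x, t). x \<in> \<Omega> \<and> 0 \<le> t \<and> \<phi> x t \<in> E}" (is "negligible ?P")
proof (subst locally_negligible_alt, rule ballI)
  fix z assume zP: "z \<in> ?P"
  then obtain x0 t0 where z: "z = (x0, t0)" "x0 \<in> \<Omega>" "0 \<le> t0" by auto
  obtain r C where r: "0 < r" and C: "0 < C"
    "\<And>x y t. x \<in> ball x0 r \<inter> \<Omega> \<Longrightarrow> y \<in> ball x0 r \<inter> \<Omega> \<Longrightarrow> t \<in> {0..t0 + 1} \<Longrightarrow>
      dist (\<phi> x t) (\<phi> y t) \<le> C * dist x y \<and> dist x y \<le> C * dist (\<phi> x t) (\<phi> y t)"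
    "\<And>x s t. x \<in> ball x0 r \<inter> \<Omega> \<Longrightarrow> s \<in> {0..t0 + 1} \<Longrightarrow> t \<in> {0..t0 + 1} \<Longrightarrow> dist (\<phi> x s) (\<phi> x t) \<le> C * dist s t"
    by (rule flow_bilipschitz[OF z(2), of "t0 + 1"]) (use z(3) in auto)
  define W where "W = ball x0 r \<times> {..<t0 + 1}"
  define U where "U = ?P \<inter> W"
  define \<Phi> where "\<Phi> p = (\<phi> (fst p) (snd p), snd p)" for p
  have U: "fst p \<in> ball x0 r \<inter> \<Omega>" "snd p \<in> {0..t0 + 1}" "\<phi> (fst p) (snd p) \<in> E" if "p \<in> U" for p
    using that by (auto simp: U_def W_def)
  have expand: "dist p q \<le> (C + C * C + 1) * dist (\<Phi> p) (\<Phi> q)" if p: "p \<in> U" and q: "q \<in> U" for p q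
  proof -
    have 1: "dist (snd p) (snd q) \<le> dist (\<Phi> p) (\<Phi> q)"
      using dist_snd_le[of "\<Phi> p" "\<Phi> q"] by (simp add: \<Phi>_def)
    have 2: "dist (\<phi> (fst p) (snd p)) (\<phi> (fst q) (snd q)) \<le> dist (\<Phi> p) (\<Phi> q)"
      using dist_fst_le[of "\<Phi> p" "\<Phi> q"] by (simp add: \<Phi>_def)
    have "dist (fst p) (fst q) \<le> C * dist (\<phi> (fst p) (snd p)) (\<phi> (fst q) (snd p))"
      using C(2)[of "fst p" "fst q" "snd p"] U[OF p] U[OF q] by blast
    also have "\<dots> \<le> C * (dist (\<phi> (fst p) (snd p)) (\<phi> (fst q) (snd q)) + dist (\<phi> (fst q) (snd q)) (\<phi> (fst q) (snd p)))"
      using C(1) by (intro mult_left_mono dist_triangle) auto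
    also have "\<dots> \<le> C * (dist (\<Phi> p) (\<Phi> q) + C * dist (\<Phi> p) (\<Phi> q))"
    proof (intro mult_left_mono add_mono 2)
      have "dist (\<phi> (fst q) (snd q)) (\<phi> (fst q) (snd p)) \<le> C * dist (snd q) (snd p)"
        using C(3) U[OF p] U[OF q] by blast
      also have "\<dots> \<le> C * dist (\<Phi> p) (\<Phi> q)" using 1 C(1) by (simp add: dist_commute)
      finally show "dist (\<phi> (fst q) (snd q)) (\<phi> (fst q) (snd p)) \<le> C * dist (\<Phi> p) (\<Phi> q)" .
    qed (use C(1) in simp)
    finally have "dist (fst p) (fst q) \<le> (C + C * C) * dist (\<Phi> p) (\<Phi> q)" by (simp add: algebra_simps)
    moreover have "dist p q \<le> dist (fst p) (fst q) + dist (snd p) (snd q)"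
      unfolding dist_prod_def by (rule sqrt_sum_squares_le_sum) auto
    ultimately show ?thesis using 1 by (simp add: algebra_simps)
  qed
  have inj: "inj_on \<Phi> U"
  proof (rule inj_onI)
    fix p q assume "p \<in> U" "q \<in> U" "\<Phi> p = \<Phi> q"
    then show "p = q" using expand[of p q] by simp
  qed
  have "negligible (\<Phi> ` U)"
  proof (rule negligible_subset)
    show "negligible (E \<times> (UNIV :: real set))"
      using E by (rule negligible_Times_UNIV)
    show "\<Phi> ` U \<subseteq> E \<times> UNIV" using U(3) by (auto simp: \<Phi>_def)
  qed
  then have "negligible (the_inv_into U \<Phi> ` (\<Phi> ` U))"
  proof (rule negligible_locally_Lipschitz_image[rotated])
    fix w assume "w \<in> \<Phi> ` U"
    then obtain p where p: "p \<in> U" "w = \<Phi> p" by blast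
    show "\<exists>T B. open T \<and> w \<in> T \<and>
        (\<forall>y\<in>\<Phi> ` U \<inter> T. norm (the_inv_into U \<Phi> y - the_inv_into U \<Phi> w) \<le> B * norm (y - w))"
    proof (intro exI[of _ UNIV] exI[of _ "C + C * C + 1"] conjI ballI)
      fix y assume "y \<in> \<Phi> ` U \<inter> UNIV"
      then obtain q where q: "q \<in> U" "y = \<Phi> q" by blast
      show "norm (the_inv_into U \<Phi> y - the_inv_into U \<Phi> w) \<le> (C + C * C + 1) * norm (y - w)"
        using expand[OF q(1) p(1)] by (simp add: p q the_inv_into_f_f[OF inj] dist_norm)
    qed auto
  qed simp
  moreover have "the_inv_into U \<Phi> ` (\<Phi> ` U) = U"
    using the_inv_into_onto[OF inj] .
  ultimately have "negligible U" by simp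
  moreover have "openin (top_of_set ?P) U"
    unfolding U_def W_def by (intro openin_open_Int open_Times) auto
  moreover have "z \<in> U" using zP z r by (auto simp: U_def W_def)
  ultimately show "\<exists>U. openin (top_of_set ?P) U \<and> z \<in> U \<and> negligible U" by blast
qed

end

text \<open>Fubini's theorem applies to a Borel null set that contains \<open>P\<close>.\<close>

lemma negligible_imp_AE_negligible_section:
  fixes P :: "('a::euclidean_space \<times> 'b::euclidean_space) set"
  assumes "negligible P"
  obtains N where "negligible N" "\<And>x. x \<notin> N \<Longrightarrow> negligible {y. (x, y) \<in> P}"
proof -
  have "P \<in> null_sets (completion lborel)" using assms by (simp add: negligible_iff_null_sets)
  then obtain B where B: "B \<in> null_sets lborel" "P \<subseteq> B"
    using null_sets_completion_subset null_sets_completion_iff2 by metis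
  then have "AE z in (lborel :: 'a measure) \<Otimes>\<^sub>M (lborel :: 'b measure). z \<notin> B"
    by (simp add: lborel_prod AE_not_in)
  then have "AE x in (lborel :: 'a measure). AE y in (lborel :: 'b measure). (x, y) \<notin> B"
    by (rule lborel_pair.AE_pair)
  then obtain N where N: "N \<in> null_sets lborel" "{x. \<not> (AE y in (lborel :: 'b measure). (x, y) \<notin> B)} \<subseteq> N"
    by (auto elim!: AE_E simp: null_sets_def)
  show thesis
  proof (rule that[of N])
    show "negligible N" using N(1) by (simp add: negligible_iff_null_sets null_sets_completionI)
    fix x assume "x \<notin> N"
    then have "AE y in (lborel :: 'b measure). (x, y) \<notin> B" using N(2) by blast
    then have "AE y in (lebesgue :: 'b measure). (x, y) \<notin> B" by (rule AE_completion)
    then show "negligible {y. (x, y) \<in> P}"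
      using B(2) unfolding eventually_ae_filter_negligible
      by (blast intro: negligible_subset)
  qed
qed

section \<open>The comparison function\<close>

locale strictly_decreasing_comparison =
  fixes \<rho> :: "real \<Rightarrow> real" and \<beta> :: "real \<Rightarrow> real \<Rightarrow> real"
  assumes rho_continuous: "continuous_on {0<..} \<rho>"
    and unique: "unique_comparison_solution \<rho> \<beta>"
    and decreasing: "\<forall>y>0. strict_antimono_on {0..} (\<beta> y)"
    and beta_locally_lipschitz: "locally_lipschitz_on ({0..} \<times> {0..}) (\<lambda>(y, t). \<beta> y t)"
begin

lemma beta_nonneg: "0 \<le> y \<Longrightarrow> 0 \<le> t \<Longrightarrow> 0 \<le> \<beta> y t"
  and beta_continuous: "continuous_on ({0..} \<times> {0..}) (\<lambda>(y, t). \<beta> y t)"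
  and beta_0: "0 \<le> y \<Longrightarrow> \<beta> y 0 = y"
  and beta_deriv: "0 \<le> y \<Longrightarrow> 0 \<le> t \<Longrightarrow> (\<beta> y has_real_derivative \<rho> (\<beta> y t)) (at t within {0..})"
  using unique unfolding unique_comparison_solution_def comparison_solution_def by blast+

lemma beta_strict: "0 < y \<Longrightarrow> 0 \<le> s \<Longrightarrow> s < t \<Longrightarrow> \<beta> y t < \<beta> y s"
  using decreasing by (auto simp: monotone_on_def)

lemma beta_pos: "0 < y \<Longrightarrow> 0 \<le> t \<Longrightarrow> 0 < \<beta> y t"
  using beta_strict[of y t "t + 1"] beta_nonneg[of y "t + 1"] by simp

text \<open>Switching at time \<open>s\<close> from \<open>\<beta> y\<close> to the solution that starts in \<open>\<beta> y s\<close> gives again a continuous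
family of solutions, and there is only one such family. Uniqueness is assumed for whole families and
not for single initial values, so the switch is made for all \<open>y\<close> at the same time \<open>s\<close>.\<close>

lemma beta_semigroup:
  assumes y: "0 \<le> y" and s: "0 \<le> s" and t: "0 \<le> t"
  shows "\<beta> (\<beta> y s) t = \<beta> y (s + t)"
proof -
  define \<gamma> where "\<gamma> y t = (if t \<in> {..s} then \<beta> y t else \<beta> (\<beta> y s) (t - s))" for y t
  have "comparison_solution \<rho> \<gamma>" unfolding comparison_solution_def
  proof (intro conjI allI impI)
    show "0 \<le> \<gamma> y t" if "0 \<le> y" "0 \<le> t" for y t
      using that beta_nonneg s by (simp add: \<gamma>_def)
    show "\<gamma> y 0 = y" if "0 \<le> y" for y using that beta_0 s by (simp add: \<gamma>_def)
    have cont_fst: "continuous_on ({0..} \<times> {s..}) (\<lambda>p. \<beta> (fst p) s)"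
    proof -
      have "continuous_on ({0::real..} \<times> {s..}) (\<lambda>p. (fst p, s))" by (intro continuous_intros)
      from continuous_on_compose2[OF beta_continuous this] show ?thesis using s by fastforce
    qed
    have "continuous_on ({0..} \<times> {s..}) (\<lambda>p. (\<beta> (fst p) s, snd p - s))"
      by (intro continuous_intros cont_fst)
    from continuous_on_compose2[OF beta_continuous this]
    have cont2: "continuous_on ({0..} \<times> {s..}) (\<lambda>p. \<beta> (\<beta> (fst p) s) (snd p - s))"
      using s beta_nonneg by fastforce
    have cont1: "continuous_on ({0..} \<times> {0..s}) (\<lambda>p. \<beta> (fst p) (snd p))"
      using continuous_on_subset[OF beta_continuous, of "{0..} \<times> {0..s}"] by (simp add: case_prod_beta Sigma_mono)
    have "continuous_on (({0..} \<times> {0..s}) \<union> ({0..} \<times> {s..}))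
        (\<lambda>p. if snd p \<le> s then \<beta> (fst p) (snd p) else \<beta> (\<beta> (fst p) s) (snd p - s))"
      by (rule continuous_on_cases[OF _ _ cont1 cont2])
        (use s beta_0 beta_nonneg in \<open>auto intro!: closed_Times\<close>)
    moreover have "{0..} \<times> {0..s} \<union> {0..} \<times> {s..} = {0::real..} \<times> {0..}" using s by auto
    moreover have "(\<lambda>p. if snd p \<le> s then \<beta> (fst p) (snd p) else \<beta> (\<beta> (fst p) s) (snd p - s)) = (\<lambda>(y, t). \<gamma> y t)"
      by (auto simp: \<gamma>_def)
    ultimately show "continuous_on ({0..} \<times> {0..}) (\<lambda>(y, t). \<gamma> y t)"
      by (simp only:)
    show "(\<gamma> y has_real_derivative \<rho> (\<gamma> y t)) (at t within {0..})" if y: "0 \<le> y" and t: "0 \<le> t" for y t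
    proof -
      have "((\<lambda>t. if t \<in> {0..s} then \<beta> y t else \<beta> (\<beta> y s) (t - s)) has_vector_derivative
          (if t \<in> {0..s} then \<rho> (\<beta> y t) else \<rho> (\<beta> (\<beta> y s) (t - s)))) (at t within {0..})"
      proof (rule has_vector_derivative_If_within_closures[where T = "{s<..}"])
        show "t \<in> {0..s} \<union> {s<..}" using t by auto
        show "{0..} = {0..s} \<union> {s<..}" using s by auto
        show "(\<beta> y has_vector_derivative \<rho> (\<beta> y t)) (at t within {0..s} \<union> closure {0..s} \<inter> closure {s<..})"
          using beta_deriv[OF y t] unfolding has_real_derivative_iff_has_vector_derivative
          by (rule has_vector_derivative_within_subset) (use s in auto)
        show "((\<lambda>t. \<beta> (\<beta> y s) (t - s)) has_vector_derivative \<rho> (\<beta> (\<beta> y s) (t - s)))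
            (at t within {s<..} \<union> closure {0..s} \<inter> closure {s<..})"
          if "t \<in> {s<..} \<union> closure {0..s} \<inter> closure {s<..}"
        proof -
          have "s \<le> t" using that by auto
          have "((\<lambda>t. t - s) has_real_derivative 1) (at t within {s..})" by (auto intro!: derivative_eq_intros)
          moreover have "(\<beta> (\<beta> y s) has_real_derivative \<rho> (\<beta> (\<beta> y s) (t - s))) (at (t - s) within (\<lambda>t. t - s) ` {s..})"
            by (rule DERIV_subset[OF beta_deriv]) (use beta_nonneg y s \<open>s \<le> t\<close> in auto)
          ultimately have "((\<lambda>t. \<beta> (\<beta> y s) (t - s)) has_real_derivative \<rho> (\<beta> (\<beta> y s) (t - s)) * 1) (at t within {s..})"
            by (rule DERIV_image_chain[unfolded o_def, rotated])
          then show ?thesis unfolding has_real_derivative_iff_has_vector_derivative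
            by simp (rule has_vector_derivative_within_subset, auto)
        qed
        show "\<beta> y t = \<beta> (\<beta> y s) (t - s)" "\<rho> (\<beta> y t) = \<rho> (\<beta> (\<beta> y s) (t - s))"
          if "t \<in> closure {0..s}" "t \<in> closure {s<..}"
        proof -
          have "t = s" using that by auto
          then show "\<beta> y t = \<beta> (\<beta> y s) (t - s)" "\<rho> (\<beta> y t) = \<rho> (\<beta> (\<beta> y s) (t - s))"
            using beta_0 beta_nonneg y s by auto
        qed
      qed
      then have "(\<gamma> y has_vector_derivative (if t \<in> {0..s} then \<rho> (\<beta> y t) else \<rho> (\<beta> (\<beta> y s) (t - s)))) (at t within {0..})"
        by (rule has_vector_derivative_transform[rotated 2]) (use t in \<open>auto simp: \<gamma>_def\<close>)
      then show ?thesis unfolding has_real_derivative_iff_has_vector_derivative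
        using t by (simp add: \<gamma>_def if_distrib)
    qed
  qed
  then have "\<gamma> y (s + t) = \<beta> y (s + t)"
    using unique y s t unfolding unique_comparison_solution_def by simp
  then show ?thesis using t beta_0 beta_nonneg y s by (cases "t = 0") (auto simp: \<gamma>_def)
qed

text \<open>As \<open>\<beta> y\<close> decreases, \<open>\<rho> y\<close> is at most \<open>0\<close>, and only a zero has to be excluded. At a positive zero \<open>y\<close> of \<open>\<rho>\<close>
the value \<open>\<beta> y h\<close> differs from \<open>y\<close> by \<open>o(h)\<close>. As \<open>\<beta> (\<beta> y h) t = \<beta> y (t + h)\<close> and
\<open>\<beta>\<close> is locally Lipschitz in its first argument, \<open>\<beta> y\<close> also changes by \<open>o(h)\<close> between \<open>t\<close> and \<open>t + h\<close>.
So \<open>\<beta> y\<close> is constant, although it is strictly decreasing.\<close>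

lemma rho_neg:
  assumes y: "0 < y"
  shows "\<rho> y < 0"
proof (rule ccontr)
  assume "\<not> \<rho> y < 0"
  have quot: "((\<lambda>h. (\<beta> y (t + h) - \<beta> y t) / h) \<longlongrightarrow> \<rho> (\<beta> y t)) (at_right 0)" if t: "0 \<le> t" for t
  proof -
    have "(\<beta> y has_real_derivative \<rho> (\<beta> y t)) (at t within {t<..})"
      by (rule DERIV_subset[OF beta_deriv]) (use y t in auto)
    then have "((\<lambda>z. (\<beta> y z - \<beta> y t) / (z - t)) \<longlongrightarrow> \<rho> (\<beta> y t)) (at_right t)"
      by (simp add: has_field_derivative_iff)
    then show ?thesis by (simp add: filterlim_at_right_to_0[of _ _ t] add.commute)
  qed
  have "\<rho> y \<le> 0"
  proof (rule tendsto_upperbound)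
    show "((\<lambda>h. (\<beta> y (0 + h) - \<beta> y 0) / h) \<longlongrightarrow> \<rho> y) (at_right 0)"
      using quot[of 0] beta_0[of y] y by simp
    show "\<forall>\<^sub>F h in at_right 0. (\<beta> y (0 + h) - \<beta> y 0) / h \<le> 0"
      unfolding eventually_at_right_field
      using beta_strict[OF y, of 0] by (intro exI[of _ 1]) (auto simp: divide_le_0_iff intro: less_imp_le)
  qed simp
  then have "\<rho> y = 0" using \<open>\<not> \<rho> y < 0\<close> by simp
  have stationary: "\<rho> (\<beta> y t) = 0" if t: "0 \<le> t" for t
  proof -
    obtain r L where r: "0 < r" and L: "L-lipschitz_on (ball (y, t) r \<inter> ({0..} \<times> {0..})) (\<lambda>(y, t). \<beta> y t)"
      using beta_locally_lipschitz y t unfolding locally_lipschitz_on_def by force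
    have "(\<beta> y \<longlongrightarrow> \<beta> y 0) (at 0 within {0..})"
      using DERIV_continuous[OF beta_deriv[of y 0]] y by (simp add: continuous_within)
    then have lim: "(\<beta> y \<longlongrightarrow> y) (at_right 0)"
      using beta_0[of y] y tendsto_within_subset[of "\<beta> y" _ 0 "{0..}" "{0<..}"] by fastforce
    then have "\<forall>\<^sub>F h in at_right 0. dist (\<beta> y h) y < r" using r by (rule tendstoD)
    moreover have "\<forall>\<^sub>F h in at_right (0::real). h > 0" by (rule eventually_at_right_less)
    ultimately have "\<forall>\<^sub>F h in at_right 0. norm ((\<beta> y (t + h) - \<beta> y t) / h) \<le> L * \<bar>(\<beta> y (0 + h) - \<beta> y 0) / h\<bar>"
    proof eventually_elim
      case (elim h)
      have "dist (\<beta> (\<beta> y h) t) (\<beta> y t) \<le> L * dist (\<beta> y h, t) (y, t)"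
        using lipschitz_onD[OF L, of "(\<beta> y h, t)" "(y, t)"] elim r y t beta_nonneg[of y h]
        by (simp add: dist_Pair_Pair dist_commute)
      then have "\<bar>\<beta> y (t + h) - \<beta> y t\<bar> \<le> L * \<bar>\<beta> y h - y\<bar>"
        using beta_semigroup[of y h t] elim y t by (simp add: dist_Pair_Pair dist_real_def add.commute)
      then have "\<bar>\<beta> y (t + h) - \<beta> y t\<bar> / h \<le> (L * \<bar>\<beta> y h - y\<bar>) / h"
        using elim by (intro divide_right_mono) auto
      then show ?case using elim beta_0[of y] y by simp
    qed
    moreover have "((\<lambda>h. L * \<bar>(\<beta> y (0 + h) - \<beta> y 0) / h\<bar>) \<longlongrightarrow> L * \<bar>\<rho> (\<beta> y 0)\<bar>) (at_right 0)"
      by (intro tendsto_intros quot) simp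
    then have "((\<lambda>h. L * \<bar>(\<beta> y (0 + h) - \<beta> y 0) / h\<bar>) \<longlongrightarrow> 0) (at_right 0)"
      using beta_0[of y] y \<open>\<rho> y = 0\<close> by simp
    ultimately have "((\<lambda>h. (\<beta> y (t + h) - \<beta> y t) / h) \<longlongrightarrow> 0) (at_right 0)"
      by (rule Lim_null_comparison)
    then show ?thesis using tendsto_unique[OF _ quot[OF t]] by auto
  qed
  have "\<exists>c. \<forall>t\<in>{0..}. \<beta> y t = c"
  proof (rule has_field_derivative_zero_constant)
    show "(\<beta> y has_field_derivative 0) (at t within {0..})" if "t \<in> {0..}" for t
      using beta_deriv[of y t] stationary[of t] that y by simp
  qed (simp add: convex_real_interval)
  then have "\<beta> y 0 = \<beta> y 1" by force
  then show False using beta_strict[OF y, of 0 1] by simp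
qed

text \<open>In this coordinate the comparison equation becomes uniform motion: \<open>time_coord (\<beta> y t) = time_coord y - t\<close>.
Shifts by \<open>t\<close> in either direction thereby replace \<open>\<beta>\<close> and its inverse, which is not defined for all
arguments. The coordinate matters on the positive half-line only.\<close>

definition time_coord :: "real \<Rightarrow> real" where
  "time_coord = (SOME \<tau>. \<forall>y>0. (\<tau> has_real_derivative - 1 / \<rho> y) (at y))"

lemma continuous_on_minus_inverse_rho: "continuous_on {0<..} (\<lambda>y. - 1 / \<rho> y)"
  using rho_neg by (intro continuous_intros rho_continuous) force

lemma time_coord_deriv:
  assumes "0 < y"
  shows "(time_coord has_real_derivative - 1 / \<rho> y) (at y)"
proof -
  have "\<exists>\<tau>. \<forall>y::real. ereal 0 < ereal y \<longrightarrow> ereal y < \<infinity> \<longrightarrow> (\<tau> has_vector_derivative - 1 / \<rho> y) (at y)"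
  proof (rule einterval_antiderivative)
    show "isCont (\<lambda>y. - 1 / \<rho> y) y" if "ereal 0 < ereal y" for y
      using continuous_on_minus_inverse_rho that by (simp add: continuous_on_eq_continuous_at)
  qed simp
  then have "\<exists>\<tau>. \<forall>y>0. (\<tau> has_real_derivative - 1 / \<rho> y) (at y)"
    by (auto simp: has_real_derivative_iff_has_vector_derivative)
  from someI_ex[OF this] show ?thesis using assms unfolding time_coord_def by blast
qed

lemma time_coord_strict_mono:
  assumes "0 < x" "x < y"
  shows "time_coord x < time_coord y"
proof (rule DERIV_pos_imp_increasing[OF assms(2)])
  fix z assume "x \<le> z" "z \<le> y"
  then show "\<exists>d. (time_coord has_real_derivative d) (at z) \<and> 0 < d"
    using time_coord_deriv[of z] rho_neg[of z] assms
    by (intro exI[of _ "- 1 / \<rho> z"]) (auto simp: divide_neg_neg zero_less_divide_iff)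
qed

lemma time_coord_le_iff:
  "0 < x \<Longrightarrow> 0 < y \<Longrightarrow> time_coord x \<le> time_coord y \<longleftrightarrow> x \<le> y"
  using time_coord_strict_mono[of x y] time_coord_strict_mono[of y x]
  by (cases x y rule: linorder_cases) auto

lemma time_coord_beta:
  assumes y: "0 < y" and t: "0 \<le> t"
  shows "time_coord (\<beta> y t) = time_coord y - t"
proof -
  have "\<exists>c. \<forall>s\<in>{0..}. time_coord (\<beta> y s) + s = c"
  proof (rule has_field_derivative_zero_constant)
    fix s :: real assume s: "s \<in> {0..}"
    then have pos: "0 < \<beta> y s" using beta_pos y by simp
    have "((\<lambda>s. time_coord (\<beta> y s)) has_real_derivative - 1 / \<rho> (\<beta> y s) * \<rho> (\<beta> y s)) (at s within {0..})"
      using DERIV_chain2[OF time_coord_deriv[OF pos] beta_deriv[of y s]] y s by simp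
    then show "((\<lambda>s. time_coord (\<beta> y s) + s) has_real_derivative 0) (at s within {0..})"
      using rho_neg[OF pos] by (auto intro!: derivative_eq_intros)
  qed simp
  then obtain c where c: "\<And>s. 0 \<le> s \<Longrightarrow> time_coord (\<beta> y s) + s = c" by auto
  from c[of 0] c[OF t] beta_0[of y] y show ?thesis by simp
qed

lemma time_coord_locally_lipschitz: "locally_lipschitz_on {0<..} time_coord"
  by (rule C1_locally_lipschitz_on[OF _ _ continuous_on_minus_inverse_rho]) (use time_coord_deriv in auto)

lemma continuous_on_time_coord: "continuous_on {0<..} time_coord"
  by (rule locally_lipschitz_on_continuous_on[OF time_coord_locally_lipschitz])

text \<open>Bounds in the coordinate can be converted back, since \<open>\<rho>\<close>, up to sign the derivative of the inverse,
is bounded on compact intervals.\<close>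

lemma time_coord_inverse_lipschitz:
  assumes a: "0 < a"
  obtains B where "0 < B"
    "\<And>v w. v \<in> {a..b} \<Longrightarrow> w \<in> {a..b} \<Longrightarrow> \<bar>v - w\<bar> \<le> B * \<bar>time_coord v - time_coord w\<bar>"
proof -
  have "bounded (\<rho> ` {a..b})"
    by (intro compact_imp_bounded compact_continuous_image continuous_on_subset[OF rho_continuous]) (use a in auto)
  then obtain B where B: "0 < B" "\<forall>y\<in>\<rho> ` {a..b}. norm y \<le> B" unfolding bounded_pos by auto
  have le: "w - v \<le> B * (time_coord w - time_coord v)" if vw: "a \<le> v" "v \<le> w" "w \<le> b" for v w
  proof (cases "v = w")
    case False
    then obtain z where z: "v < z" "z < w" "time_coord w - time_coord v = (w - v) * (- 1 / \<rho> z)"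
      using MVT2[of v w time_coord "\<lambda>y. - 1 / \<rho> y"] time_coord_deriv vw a by auto
    have "\<rho> z < 0" using rho_neg z vw a by simp
    then have "w - v = - \<rho> z * (time_coord w - time_coord v)" unfolding z(3) by simp
    also have "\<dots> \<le> B * (time_coord w - time_coord v)"
    proof (rule mult_right_mono)
      have "norm (\<rho> z) \<le> B" using z vw by (intro B(2)[rule_format] imageI) auto
      then show "- \<rho> z \<le> B" by simp
      show "0 \<le> time_coord w - time_coord v" using time_coord_le_iff[of v w] vw a by simp
    qed
    finally show ?thesis .
  qed simp
  have "\<bar>v - w\<bar> \<le> B * \<bar>time_coord v - time_coord w\<bar>" if "v \<in> {a..b}" "w \<in> {a..b}" for v w
  proof (cases "v \<le> w")
    case True
    with that le[of v w] time_coord_le_iff[of v w] a show ?thesis by (simp add: abs_minus_commute)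
  next
    case False
    with that le[of w v] time_coord_le_iff[of w v] a show ?thesis by simp
  qed
  with B(1) show thesis by (rule that)
qed

end

section \<open>Lyapunov functions\<close>

text \<open>The hypothesis on the tail reduces the supremum, for all points near \<open>x0\<close>, to one over a fixed compact
time interval, on which \<open>h\<close> has a Lipschitz constant in \<open>x\<close> that does not depend on the time.\<close>

lemma SUP_locally_lipschitz_on:
  fixes h :: "'a::metric_space \<Rightarrow> real \<Rightarrow> real"
  assumes h: "locally_lipschitz_on (S \<times> {0..}) (\<lambda>(x, t). h x t)"
    and bdd: "\<And>x. x \<in> S \<Longrightarrow> bdd_above (h x ` {0..})"
    and tail: "\<And>x0. x0 \<in> S \<Longrightarrow> \<exists>r>0. \<exists>T\<ge>0. \<forall>x\<in>ball x0 r \<inter> S. \<forall>t>T. h x t \<le> h x 0"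
  shows "locally_lipschitz_on S (\<lambda>x. SUP t\<in>{0..}. h x t)"
  unfolding locally_lipschitz_on_def
proof
  fix x0 assume x0: "x0 \<in> S"
  obtain r T where r: "0 < r" and T: "0 \<le> T" "\<And>x t. x \<in> ball x0 r \<inter> S \<Longrightarrow> T < t \<Longrightarrow> h x t \<le> h x 0"
    using tail[OF x0] by blast
  have "compact ({x0} \<times> {0..T})" "{x0} \<times> {0..T} \<subseteq> S \<times> {0..}"
    using x0 by (auto intro: compact_Times)
  from locally_lipschitz_on_uniform[OF h this]
  obtain \<delta> L where \<delta>: "0 < \<delta>" and L: "0 \<le> L"
    "\<And>k p q. k \<in> {x0} \<times> {0..T} \<Longrightarrow> p \<in> S \<times> {0..} \<Longrightarrow> q \<in> S \<times> {0..} \<Longrightarrow> dist k p < \<delta> \<Longrightarrow> dist k q < \<delta> \<Longrightarrow>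
       dist (case p of (x, t) \<Rightarrow> h x t) (case q of (x, t) \<Rightarrow> h x t) \<le> L * dist p q"
    by blast
  let ?B = "ball x0 (min r \<delta>) \<inter> S"
  have le: "(SUP t\<in>{0..}. h x t) \<le> (SUP t\<in>{0..}. h y t) + L * dist x y" if x: "x \<in> ?B" and y: "y \<in> ?B" for x y
  proof (rule cSUP_least)
    fix t :: real assume t: "t \<in> {0..}"
    have up: "h y s \<le> (SUP t\<in>{0..}. h y t)" if "0 \<le> s" for s
      using that y by (intro cSUP_upper bdd) auto
    have near: "h x s \<le> h y s + L * dist x y" if "s \<in> {0..T}" for s
      using L(2)[of "(x0, s)" "(x, s)" "(y, s)"] x y that by (simp add: dist_Pair_Pair dist_real_def abs_le_iff)
    show "h x t \<le> (SUP t\<in>{0..}. h y t) + L * dist x y"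
    proof (cases "t \<le> T")
      case True
      then show ?thesis using near[of t] up[of t] t by simp
    next
      case False
      then have "h x t \<le> h x 0" using T(2) x by simp
      also have "\<dots> \<le> h y 0 + L * dist x y" using near[of 0] T(1) by simp
      finally show ?thesis using up[of 0] by simp
    qed
  qed simp
  have "L-lipschitz_on ?B (\<lambda>x. SUP t\<in>{0..}. h x t)"
  proof (rule lipschitz_onI)
    fix x y assume "x \<in> ?B" "y \<in> ?B"
    then show "dist (SUP t\<in>{0..}. h x t) (SUP t\<in>{0..}. h y t) \<le> L * dist x y"
      using le[of x y] le[of y x] by (simp add: dist_real_def dist_commute abs_le_iff)
  qed (rule L(1))
  then show "\<exists>r>0. \<exists>L. L-lipschitz_on (ball x0 r \<inter> S) (\<lambda>x. SUP t\<in>{0..}. h x t)"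
    using r \<delta> by (intro exI[of _ "min r \<delta>"] conjI exI[of _ L]) auto
qed

lemma deriv_le_if_linear_bound:
  fixes w :: "real \<Rightarrow> real"
  assumes w: "(w has_real_derivative D) (at 0 within {0..})"
    and le: "\<And>s. 0 \<le> s \<Longrightarrow> w s \<le> w 0 - c * s"
  shows "D \<le> - c"
proof (rule tendsto_upperbound)
  have "(w has_real_derivative D) (at 0 within {0<..})" by (rule DERIV_subset[OF w]) auto
  then show "((\<lambda>s. (w s - w 0) / (s - 0)) \<longlongrightarrow> D) (at_right 0)" by (simp add: has_field_derivative_iff)
  show "\<forall>\<^sub>F s in at_right 0. (w s - w 0) / (s - 0) \<le> - c"
    using eventually_at_right_less[of "0::real"]
  proof eventually_elim
    case (elim s)
    then show ?case using le[of s] by (simp add: divide_le_eq)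
  qed
qed simp

locale stability_setting =
  lipschitz_flow \<Omega> f \<phi> + strictly_decreasing_comparison \<rho> \<beta>
  for \<Omega> :: "'a::euclidean_space set" and f \<phi> \<rho> \<beta> +
  fixes G :: "'a set" and \<alpha> :: "'a \<Rightarrow> real" and k M :: real
  assumes equilibrium: "0 \<in> \<Omega>" "f 0 = 0"
    and G_sub: "G \<subseteq> \<Omega>" and invariant: "forward_invariant \<phi> G"
    and alpha_nonneg: "\<forall>x\<in>G. 0 \<le> \<alpha> x"
    and positive_definite: "positive_definite_on G \<alpha>"
    and alpha_locally_lipschitz: "locally_lipschitz_on G \<alpha>"
    and k: "0 \<le> k" and M: "1 \<le> M"
begin

lemma flow_in_G: "x \<in> G \<Longrightarrow> 0 \<le> t \<Longrightarrow> \<phi> x t \<in> G"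
  using invariant by (simp add: forward_invariant_def)

text \<open>The equilibrium is not reached in finite time, because distinct orbits of a locally Lipschitz field
do not merge. So the time coordinate of \<open>\<alpha>\<close> stays finite along orbits.\<close>

lemma flow_in_G_minus_0:
  assumes "x \<in> G - {0}" "0 \<le> t"
  shows "\<phi> x t \<in> G - {0}"
proof -
  have "\<phi> x t \<noteq> \<phi> 0 t" using flow_inj[of x 0 t] assms G_sub equilibrium(1) by blast
  then show ?thesis using flow_at_equilibrium equilibrium assms flow_in_G by auto
qed

lemma alpha_pos: "x \<in> G - {0} \<Longrightarrow> 0 < \<alpha> x"
  using alpha_nonneg positive_definite by (force simp: positive_definite_on_def less_le)

lemma alpha_zero: "0 \<in> G \<Longrightarrow> \<alpha> 0 = 0"
  using positive_definite by (simp add: positive_definite_on_def)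

lemma alpha_continuous: "continuous_on G \<alpha>"
  by (rule locally_lipschitz_on_continuous_on[OF alpha_locally_lipschitz])

text \<open>Orbits stay in \<open>G\<close>, so the chain rule applies to a gradient within \<open>G\<close>.\<close>

lemma deriv_along_flow:
  assumes x: "x \<in> G" and t: "0 \<le> t"
    and V: "(V has_derivative (\<lambda>h. g \<bullet> h)) (at (\<phi> x t) within G)"
  shows "((\<lambda>s. V (\<phi> x s)) has_real_derivative g \<bullet> f (\<phi> x t)) (at t within {0..})"
proof -
  have "(\<phi> x has_derivative (\<lambda>h. h *\<^sub>R f (\<phi> x t))) (at t within {0..})"
    using flow_deriv[of x t] x t G_sub by (auto simp: has_vector_derivative_def)
  moreover have "(V has_derivative (\<lambda>h. g \<bullet> h)) (at (\<phi> x t) within \<phi> x ` {0..})"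
    by (rule has_derivative_subset[OF V]) (use flow_in_G x in auto)
  ultimately have "((\<lambda>s. V (\<phi> x s)) has_derivative (\<lambda>h. g \<bullet> (h *\<^sub>R f (\<phi> x t)))) (at t within {0..})"
    by (rule has_derivative_in_compose)
  then show ?thesis by (simp add: has_field_derivative_def mult.commute[of _ "g \<bullet> f (\<phi> x t)"])
qed

lemma at_within_G: "x \<noteq> 0 \<Longrightarrow> at x within (G - {0}) = at x within G"
  by (rule at_within_nhd[of x "- {0}"]) auto

lemma AE_gradient:
  assumes "locally_lipschitz_on (G - {0}) V"
    and "\<And>x g. x \<in> G - {0} \<Longrightarrow> (V has_derivative (\<lambda>h. g \<bullet> h)) (at x within G) \<Longrightarrow> P x g"
  shows "AE x in lebesgue. x \<in> G \<longrightarrow> (\<exists>g. (V has_derivative (\<lambda>h. g \<bullet> h)) (at x within G) \<and> P x g)"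
proof -
  obtain N where N: "negligible N"
    "\<And>x. x \<in> (G - {0}) - N \<Longrightarrow> \<exists>g. (V has_derivative (\<lambda>h. g \<bullet> h)) (at x within (G - {0}))"
    using Rademacher_locally_lipschitz_on[OF assms(1)] by metis
  show ?thesis unfolding eventually_ae_filter_negligible
  proof (intro exI[of _ "insert 0 N"] conjI subsetI)
    fix x assume x: "x \<in> {x. \<not> (x \<in> G \<longrightarrow> (\<exists>g. (V has_derivative (\<lambda>h. g \<bullet> h)) (at x within G) \<and> P x g))}"
    show "x \<in> insert 0 N"
    proof (rule ccontr)
      assume "x \<notin> insert 0 N"
      with x have x': "x \<in> (G - {0}) - N" by auto
      then obtain g where "(V has_derivative (\<lambda>h. g \<bullet> h)) (at x within G)"
        using N(2)[OF x'] at_within_G[of x] by auto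
      with x x' assms(2)[of x g] show False by blast
    qed
  qed (use N(1) in simp)
qed

text \<open>With rate \<open>0\<close> and gain \<open>1\<close>, stability says that \<open>\<alpha>\<close> itself does not increase along orbits.\<close>

lemma lyapunov_function_if_stable_k0:
  assumes stable: "beta_stable_on G \<phi> \<alpha> \<beta> k M" and "k = 0" "M = 1"
  shows "lyapunov_function f G \<alpha> \<rho> k M \<epsilon> \<alpha>"
  unfolding lyapunov_function_def
proof (intro conjI)
  show "locally_lipschitz_on (G - {0}) \<alpha>"
    by (rule locally_lipschitz_on_subset[OF alpha_locally_lipschitz]) auto
  then show "AE x in lebesgue. x \<in> G \<longrightarrow> (\<exists>g. (\<alpha> has_derivative (\<lambda>h. g \<bullet> h)) (at x within G) \<and> g \<bullet> f x \<le> (1 - \<epsilon>) * k * \<rho> (\<alpha> x))"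
  proof (rule AE_gradient)
    fix x g assume x: "x \<in> G - {0}" and g: "(\<alpha> has_derivative (\<lambda>h. g \<bullet> h)) (at x within G)"
    have x0: "\<phi> x 0 = x" using flow_0 x G_sub by blast
    have "((\<lambda>s. \<alpha> (\<phi> x s)) has_real_derivative g \<bullet> f (\<phi> x 0)) (at 0 within {0..})"
      by (rule deriv_along_flow) (use x x0 g in auto)
    then have "g \<bullet> f (\<phi> x 0) \<le> - 0"
    proof (rule deriv_le_if_linear_bound)
      fix s :: real assume "0 \<le> s"
      then show "\<alpha> (\<phi> x s) \<le> \<alpha> (\<phi> x 0) - 0 * s"
        using stable x beta_0[of "\<alpha> x"] alpha_pos[OF x] by (auto simp: beta_stable_on_def assms(2,3) x0)
    qed
    then show "g \<bullet> f x \<le> (1 - \<epsilon>) * k * \<rho> (\<alpha> x)" by (simp add: x0 \<open>k = 0\<close>)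
  qed
qed (use alpha_nonneg alpha_continuous \<open>M = 1\<close> in auto)

text \<open>In the time coordinate the gradient inequality says that \<open>V\<close> decreases at least at the rate
\<open>(1 - \<epsilon>) * k\<close>. It holds at almost every point of \<open>G\<close>, hence, for almost every initial point, at almost
every time, and integration gives the claim for such initial points. Both sides of the claim are
continuous in \<open>x\<close>, so a violation would occur on a whole relative neighbourhood, which is not null.\<close>

lemma stable_up_to_epsilon_if_lyapunov_function:
  assumes lyap: "lyapunov_function f G \<alpha> \<rho> k M \<epsilon> V" and \<epsilon>: "0 < \<epsilon>" "\<epsilon> < 1"
    and nonnull: "locally_nonnull G" and x: "x \<in> G - {0}" and t: "0 \<le> t"
  shows "\<alpha> (\<phi> x t) \<le> M * \<beta> (\<alpha> x) ((1 - \<epsilon>) * k * t)"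
proof -
  define c where "c = (1 - \<epsilon>) * k"
  have c: "0 \<le> c" using \<epsilon> k by (simp add: c_def)
  have V_ll: "locally_lipschitz_on (G - {0}) V"
    and V_bounds: "\<And>x. x \<in> G \<Longrightarrow> \<alpha> x \<le> M * V x \<and> V x \<le> \<alpha> x"
    and V_AE: "AE x in lebesgue. x \<in> G \<longrightarrow> (\<exists>g. (V has_derivative (\<lambda>h. g \<bullet> h)) (at x within G) \<and> g \<bullet> f x \<le> c * \<rho> (V x))"
    using lyap M unfolding lyapunov_function_def c_def by (auto simp: field_simps)
  have V_pos: "0 < V x" if "x \<in> G - {0}" for x
  proof -
    have "0 < M * V x" using V_bounds[of x] alpha_pos[OF that] that by auto
    then show ?thesis using M by (simp add: zero_less_mult_iff)
  qed
  obtain N where N: "negligible N"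
    "\<And>x. x \<in> G - N \<Longrightarrow> \<exists>g. (V has_derivative (\<lambda>h. g \<bullet> h)) (at x within G) \<and> g \<bullet> f x \<le> c * \<rho> (V x)"
    using V_AE unfolding eventually_ae_filter_negligible by blast
  obtain N1 where N1: "negligible N1"
    "\<And>x. x \<notin> N1 \<Longrightarrow> negligible {s. (x, s) \<in> {(x, s). x \<in> \<Omega> \<and> 0 \<le> s \<and> \<phi> x s \<in> N}}"
    using negligible_imp_AE_negligible_section[OF negligible_flow_preimage[OF N(1)]] by blast
  have good: "\<alpha> (\<phi> x t) \<le> M * \<beta> (\<alpha> x) (c * t)" if x: "x \<in> G - {0}" and "x \<notin> N1" for x
  proof -
    have xO: "x \<in> \<Omega>" using x G_sub by auto
    have orbit: "\<phi> x ` {0..t} \<subseteq> G - {0}" using flow_in_G_minus_0[OF x] by auto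
    have "locally_lipschitz_on {0..t} (\<lambda>s. \<phi> x s)"
    proof -
      have "locally_lipschitz_on {0..t} (\<lambda>s. (x, s))"
        by (rule lipschitz_imp_locally_lipschitz_on[of 1]) (simp add: lipschitz_on_def dist_Pair_Pair)
      moreover have "(\<lambda>s. (x, s)) ` {0..t} \<subseteq> \<Omega> \<times> {0..}" using xO by auto
      ultimately show ?thesis using locally_lipschitz_on_compose[OF _ flow_locally_lipschitz] by fastforce
    qed
    from locally_lipschitz_on_compose[OF this V_ll orbit]
    have "locally_lipschitz_on {0..t} (\<lambda>s. V (\<phi> x s))" .
    then have "locally_lipschitz_on {0..t} (\<lambda>s. time_coord (V (\<phi> x s)))"
      by (rule locally_lipschitz_on_compose[OF _ time_coord_locally_lipschitz]) (use V_pos flow_in_G_minus_0[OF x] in auto)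
    then obtain L where L: "L-lipschitz_on {0..t} (\<lambda>s. time_coord (V (\<phi> x s)))"
      using locally_lipschitz_on_compact_imp_lipschitz compact_Icc by blast
    have "time_coord (V (\<phi> x t)) - time_coord (V (\<phi> x 0)) \<le> - c * (t - 0)"
    proof (rule lipschitz_AE_deriv_le_imp_le[OF t L N1(2)[OF \<open>x \<notin> N1\<close>]])
      fix s assume s: "s \<in> {0<..<t} - {s. (x, s) \<in> {(x, s). x \<in> \<Omega> \<and> 0 \<le> s \<and> \<phi> x s \<in> N}}"
      then have s0: "0 \<le> s" and "\<phi> x s \<in> G - N" using xO flow_in_G x by auto
      then obtain g where g: "(V has_derivative (\<lambda>h. g \<bullet> h)) (at (\<phi> x s) within G)"
        "g \<bullet> f (\<phi> x s) \<le> c * \<rho> (V (\<phi> x s))" using N(2) by blast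
      have Vs: "0 < V (\<phi> x s)" using V_pos flow_in_G_minus_0[OF x s0] by blast
      have "((\<lambda>s. V (\<phi> x s)) has_real_derivative g \<bullet> f (\<phi> x s)) (at s within {0..})"
        by (rule deriv_along_flow) (use x s0 g in auto)
      then have "((\<lambda>s. V (\<phi> x s)) has_real_derivative g \<bullet> f (\<phi> x s)) (at s)"
        using s at_within_interior[of s "{0..}"] by simp
      from DERIV_chain2[OF time_coord_deriv[OF Vs] this]
      have "((\<lambda>s. time_coord (V (\<phi> x s))) has_real_derivative - 1 / \<rho> (V (\<phi> x s)) * (g \<bullet> f (\<phi> x s))) (at s)" .
      moreover have "- 1 / \<rho> (V (\<phi> x s)) * (g \<bullet> f (\<phi> x s)) \<le> - c"
        using g(2) rho_neg[OF Vs] by (simp add: field_simps)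
      ultimately show "\<exists>D. ((\<lambda>s. time_coord (V (\<phi> x s))) has_real_derivative D) (at s) \<and> D \<le> - c" by blast
    qed
    then have "time_coord (V (\<phi> x t)) \<le> time_coord (V x) - c * t" using flow_0[OF xO] by simp
    also have "\<dots> \<le> time_coord (\<alpha> x) - c * t" using V_bounds[of x] V_pos[OF x] alpha_pos[OF x] x by (simp add: time_coord_le_iff)
    also have "\<dots> = time_coord (\<beta> (\<alpha> x) (c * t))" using alpha_pos[OF x] c t by (simp add: time_coord_beta)
    finally have "V (\<phi> x t) \<le> \<beta> (\<alpha> x) (c * t)"
      using V_pos[OF flow_in_G_minus_0[OF x t]] alpha_pos[OF x] beta_pos c t by (simp add: time_coord_le_iff)
    then have "M * V (\<phi> x t) \<le> M * \<beta> (\<alpha> x) (c * t)" using M by simp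
    then show ?thesis using V_bounds[of "\<phi> x t"] flow_in_G[of x t] x t by auto
  qed
  show ?thesis
  proof (rule ccontr)
    assume "\<not> ?thesis"
    then have viol: "M * \<beta> (\<alpha> x) (c * t) - \<alpha> (\<phi> x t) < 0" by (simp add: c_def)
    define F where "F y = M * \<beta> (\<alpha> y) (c * t) - \<alpha> (\<phi> y t)" for y
    have "continuous_on G F"
    proof -
      have "continuous_on G (\<lambda>y. (\<alpha> y, c * t))" by (intro continuous_intros alpha_continuous)
      from continuous_on_compose2[OF beta_continuous this] alpha_nonneg c t
      have 1: "continuous_on G (\<lambda>y. \<beta> (\<alpha> y) (c * t))" by (auto simp: image_subset_iff)
      have "continuous_on G (\<lambda>y. (y, t))" by (intro continuous_intros)
      from continuous_on_compose2[OF flow_continuous this] G_sub t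
      have "continuous_on G (\<lambda>y. \<phi> y t)" by (auto simp: image_subset_iff)
      from continuous_on_compose2[OF alpha_continuous this] flow_in_G t
      have "continuous_on G (\<lambda>y. \<alpha> (\<phi> y t))" by (auto simp: image_subset_iff)
      with 1 show ?thesis unfolding F_def by (intro continuous_intros)
    qed
    then obtain d where d: "0 < d" "\<And>y. y \<in> G \<Longrightarrow> dist y x < d \<Longrightarrow> dist (F y) (F x) < - F x"
      using x viol unfolding continuous_on_iff F_def by (metis DiffD1 neg_0_less_iff_less)
    have "ball x d \<inter> G \<subseteq> insert 0 N1"
    proof
      fix y assume y: "y \<in> ball x d \<inter> G"
      then have "F y < 0" using d(2)[of y] by (auto simp: dist_commute dist_real_def)
      then show "y \<in> insert 0 N1" using good[of y] y by (force simp: F_def)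
    qed
    then have "negligible (ball x d \<inter> G)" using N1(1) by (meson negligible_insert negligible_subset)
    then show False using nonnull x d(1) unfolding locally_nonnull_def by blast
  qed
qed

text \<open>The bounds for all rates below \<open>k\<close> yield the bound for \<open>k\<close> by continuity of \<open>\<beta>\<close> in time.\<close>

lemma stable_if_lyapunov_functions:
  assumes lyap: "\<And>\<epsilon>. 0 < \<epsilon> \<Longrightarrow> \<epsilon> < 1 \<Longrightarrow> \<exists>V. lyapunov_function f G \<alpha> \<rho> k M \<epsilon> V"
    and nonnull: "locally_nonnull G"
  shows "beta_stable_on G \<phi> \<alpha> \<beta> k M"
  unfolding beta_stable_on_def
proof (intro ballI allI impI)
  fix x t assume x: "x \<in> G" and t: "(0::real) \<le> t"
  show "\<alpha> (\<phi> x t) \<le> M * \<beta> (\<alpha> x) (k * t)"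
  proof (cases "x = 0")
    case True
    then show ?thesis
      using flow_at_equilibrium equilibrium t x alpha_zero beta_nonneg[of 0 "k * t"] k M by simp
  next
    case False
    with x have x': "x \<in> G - {0}" by simp
    have 1: "continuous_on {0..1} (\<lambda>\<epsilon>. (1 - \<epsilon>) * k * t)" by (intro continuous_intros)
    have 2: "continuous_on {0..} (\<beta> (\<alpha> x))"
      using DERIV_continuous[OF beta_deriv[of "\<alpha> x"]] alpha_nonneg x
      by (auto simp: continuous_on_eq_continuous_within)
    have "(\<lambda>\<epsilon>. (1 - \<epsilon>) * k * t) ` {0..1} \<subseteq> {0..}" using k t by auto
    then have "continuous_on {0..1} (\<lambda>\<epsilon>. \<beta> (\<alpha> x) ((1 - \<epsilon>) * k * t))"
      by (rule continuous_on_compose2[OF 2 1])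
    then have "((\<lambda>\<epsilon>. \<beta> (\<alpha> x) ((1 - \<epsilon>) * k * t)) \<longlongrightarrow> \<beta> (\<alpha> x) ((1 - 0) * k * t)) (at_right 0)"
      by (auto dest!: continuous_on_Icc_at_rightD)
    then have lim: "((\<lambda>\<epsilon>. M * \<beta> (\<alpha> x) ((1 - \<epsilon>) * k * t)) \<longlongrightarrow> M * \<beta> (\<alpha> x) (k * t)) (at_right 0)"
      by (intro tendsto_intros) simp
    show ?thesis
    proof (rule tendsto_lowerbound[OF lim])
      show "\<forall>\<^sub>F \<epsilon> in at_right 0. \<alpha> (\<phi> x t) \<le> M * \<beta> (\<alpha> x) ((1 - \<epsilon>) * k * t)"
        unfolding eventually_at_right_field
        using lyap stable_up_to_epsilon_if_lyapunov_function[OF _ _ _ nonnull x' t] by (intro exI[of _ 1]) auto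
    qed simp
  qed
qed

end

locale beta_stable_setting = stability_setting +
  fixes \<epsilon> :: real
  assumes stable: "beta_stable_on G \<phi> \<alpha> \<beta> k M"
    and k_pos: "0 < k" and eps: "0 < \<epsilon>" "\<epsilon> < 1"
begin

definition rate :: real where "rate = (1 - \<epsilon>) * k"

text \<open>Had \<open>\<alpha> / M\<close> decayed at exactly the rate \<open>(1 - \<epsilon>) * k\<close> up to time \<open>t\<close>, this would be the time coordinate of
its initial value.\<close>

definition backdated_coord :: "'a \<Rightarrow> real \<Rightarrow> real" where
  "backdated_coord x t = time_coord (\<alpha> (\<phi> x t) / M) + rate * t"

text \<open>Taking the supremum over all later times gives a quantity that decreases along orbits at the rate
\<open>(1 - \<epsilon>) * k\<close>, whatever the orbit does in between.\<close>

definition sup_backdated_coord :: "'a \<Rightarrow> real" where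
  "sup_backdated_coord x = (SUP t\<in>{0..}. backdated_coord x t)"

text \<open>The Lyapunov function is the value whose time coordinate is the supremum.\<close>

definition lyap :: "'a \<Rightarrow> real" where
  "lyap x = (if x = 0 then 0 else SOME v. \<alpha> x / M \<le> v \<and> v \<le> \<alpha> x \<and> time_coord v = sup_backdated_coord x)"

lemma backdated_coord_0: "x \<in> G \<Longrightarrow> backdated_coord x 0 = time_coord (\<alpha> x / M)"
  using flow_0 G_sub by (auto simp: backdated_coord_def)

text \<open>Stability gives decay at the full rate \<open>k\<close>. The gap of \<open>\<epsilon> * k\<close> bounds the supremum by the time coordinate
of \<open>\<alpha>\<close> and makes late times irrelevant for it.\<close>

lemma backdated_coord_upper:
  assumes x: "x \<in> G - {0}" and t: "0 \<le> t"
  shows "backdated_coord x t \<le> time_coord (\<alpha> x) - \<epsilon> * k * t"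
proof -
  have "\<alpha> (\<phi> x t) \<le> M * \<beta> (\<alpha> x) (k * t)" using stable x t by (simp add: beta_stable_on_def)
  then have "\<alpha> (\<phi> x t) / M \<le> \<beta> (\<alpha> x) (k * t)" using M by (simp add: divide_le_eq mult.commute)
  then have "time_coord (\<alpha> (\<phi> x t) / M) \<le> time_coord (\<beta> (\<alpha> x) (k * t))"
    using alpha_pos[OF flow_in_G_minus_0[OF x t]] alpha_pos[OF x] beta_pos k t M
    by (subst time_coord_le_iff) auto
  also have "\<dots> = time_coord (\<alpha> x) - k * t" using alpha_pos[OF x] k t by (simp add: time_coord_beta)
  finally show ?thesis by (simp add: backdated_coord_def rate_def algebra_simps)
qed

lemma backdated_coord_le:
  assumes "x \<in> G - {0}" "0 \<le> t"
  shows "backdated_coord x t \<le> time_coord (\<alpha> x)"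
proof -
  have "0 \<le> \<epsilon> * k * t" using eps k assms(2) by simp
  with backdated_coord_upper[OF assms] show ?thesis by linarith
qed

lemma bdd_above_backdated_coord: "x \<in> G - {0} \<Longrightarrow> bdd_above (backdated_coord x ` {0..})"
  using backdated_coord_le by (intro bdd_aboveI2) auto

lemma sup_backdated_coord_bounds:
  assumes x: "x \<in> G - {0}"
  shows "time_coord (\<alpha> x / M) \<le> sup_backdated_coord x" "sup_backdated_coord x \<le> time_coord (\<alpha> x)"
proof -
  show "time_coord (\<alpha> x / M) \<le> sup_backdated_coord x"
    using cSUP_upper[OF _ bdd_above_backdated_coord[OF x], of 0] backdated_coord_0[of x] x by (simp add: sup_backdated_coord_def)
  show "sup_backdated_coord x \<le> time_coord (\<alpha> x)"
    unfolding sup_backdated_coord_def using backdated_coord_le[OF x] by (intro cSUP_least) auto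
qed

lemma sup_backdated_coord_flow:
  assumes x: "x \<in> G - {0}" and s: "0 \<le> s"
  shows "sup_backdated_coord (\<phi> x s) \<le> sup_backdated_coord x - rate * s"
  unfolding sup_backdated_coord_def
proof (rule cSUP_least)
  fix t :: real assume t: "t \<in> {0..}"
  have "backdated_coord (\<phi> x s) t = backdated_coord x (s + t) - rate * s"
    using flow_add[of x s t] x s t G_sub by (auto simp: backdated_coord_def algebra_simps)
  also have "backdated_coord x (s + t) \<le> (SUP t\<in>{0..}. backdated_coord x t)"
    using bdd_above_backdated_coord[OF x] s t by (intro cSUP_upper) auto
  finally show "backdated_coord (\<phi> x s) t \<le> (SUP t\<in>{0..}. backdated_coord x t) - rate * s" by simp
qed simp

lemma lyap_props:
  assumes x: "x \<in> G - {0}"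
  shows "\<alpha> x / M \<le> lyap x" "lyap x \<le> \<alpha> x" "time_coord (lyap x) = sup_backdated_coord x" "0 < lyap x"
proof -
  have pos: "0 < \<alpha> x / M" using alpha_pos[OF x] M by simp
  have "\<exists>v\<ge>\<alpha> x / M. v \<le> \<alpha> x \<and> time_coord v = sup_backdated_coord x"
  proof (rule IVT')
    show "\<alpha> x / M \<le> \<alpha> x" using alpha_pos[OF x] M by (simp add: divide_le_eq mult_le_cancel_left1)
    show "continuous_on {\<alpha> x / M..\<alpha> x} time_coord"
      by (rule continuous_on_subset[OF continuous_on_time_coord]) (use pos in auto)
  qed (use sup_backdated_coord_bounds[OF x] in auto)
  from someI_ex[OF this] show lyap: "\<alpha> x / M \<le> lyap x" "lyap x \<le> \<alpha> x" "time_coord (lyap x) = sup_backdated_coord x"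
    using x by (auto simp: lyap_def)
  show "0 < lyap x" using pos lyap(1) by linarith
qed

lemma alpha_near:
  assumes x0: "x0 \<in> G - {0}"
  obtains r where "0 < r"
    "\<And>x. x \<in> ball x0 r \<inter> (G - {0}) \<Longrightarrow> \<alpha> x0 / 2 < \<alpha> x \<and> \<alpha> x < 2 * \<alpha> x0"
proof -
  obtain d where d: "0 < d" "\<And>x. x \<in> G \<Longrightarrow> dist x x0 < d \<Longrightarrow> dist (\<alpha> x) (\<alpha> x0) < \<alpha> x0 / 2"
    using alpha_continuous x0 alpha_pos[OF x0] unfolding continuous_on_iff by (metis DiffD1 half_gt_zero)
  have "\<alpha> x0 / 2 < \<alpha> x \<and> \<alpha> x < 2 * \<alpha> x0" if "x \<in> ball x0 d \<inter> (G - {0})" for x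
  proof -
    have "\<bar>\<alpha> x - \<alpha> x0\<bar> < \<alpha> x0 / 2" using d(2)[of x] that by (simp add: dist_real_def dist_commute)
    with alpha_pos[OF x0] show ?thesis by linarith
  qed
  with d(1) show thesis by (rule that)
qed

text \<open>The map \<open>backdated_coord\<close> is composed of locally Lipschitz functions. By the gap in the rates, times
after which \<open>\<epsilon> * k * t\<close> exceeds the distance of the coordinates of \<open>2 * \<alpha>\<close> and \<open>\<alpha> / (2 * M)\<close> lose
against time \<open>0\<close> near \<open>x0\<close>.\<close>

lemma sup_backdated_coord_locally_lipschitz: "locally_lipschitz_on (G - {0}) sup_backdated_coord"
  unfolding sup_backdated_coord_def
proof (rule SUP_locally_lipschitz_on[OF _ bdd_above_backdated_coord])
  have "locally_lipschitz_on ((G - {0}) \<times> {0..}) (\<lambda>p. case p of (x, t) \<Rightarrow> \<phi> x t)"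
    by (rule locally_lipschitz_on_subset[OF flow_locally_lipschitz]) (use G_sub in auto)
  then have "locally_lipschitz_on ((G - {0}) \<times> {0..}) (\<lambda>p. \<alpha> (case p of (x, t) \<Rightarrow> \<phi> x t))"
    by (rule locally_lipschitz_on_compose[OF _ alpha_locally_lipschitz]) (use flow_in_G in auto)
  moreover have "locally_lipschitz_on UNIV (\<lambda>y::real. y / M)"
    using M by (intro lipschitz_imp_locally_lipschitz_on[of 1] lipschitz_onI)
      (auto simp: dist_real_def abs_divide divide_le_eq mult_le_cancel_left1 simp flip: diff_divide_distrib)
  ultimately have "locally_lipschitz_on ((G - {0}) \<times> {0..}) (\<lambda>p. \<alpha> (case p of (x, t) \<Rightarrow> \<phi> x t) / M)"
    by (rule locally_lipschitz_on_compose) auto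
  then have "locally_lipschitz_on ((G - {0}) \<times> {0..}) (\<lambda>p. time_coord (\<alpha> (case p of (x, t) \<Rightarrow> \<phi> x t) / M))"
  proof (rule locally_lipschitz_on_compose[OF _ time_coord_locally_lipschitz])
    show "(\<lambda>p. \<alpha> (case p of (x, t) \<Rightarrow> \<phi> x t) / M) ` ((G - {0}) \<times> {0..}) \<subseteq> {0<..}"
      using alpha_pos[OF flow_in_G_minus_0] M by fastforce
  qed
  moreover have "locally_lipschitz_on ((G - {0}) \<times> {0..}) (\<lambda>p. rate * snd p)"
  proof (rule lipschitz_imp_locally_lipschitz_on[of "\<bar>rate\<bar>"], rule lipschitz_onI)
    fix p q :: "'a \<times> real"
    show "dist (rate * snd p) (rate * snd q) \<le> \<bar>rate\<bar> * dist p q"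
      using mult_left_mono[OF dist_snd_le[of p q], of "\<bar>rate\<bar>"]
      by (simp add: dist_real_def abs_mult flip: right_diff_distrib)
  qed simp
  ultimately have "locally_lipschitz_on ((G - {0}) \<times> {0..}) (\<lambda>p. time_coord (\<alpha> (case p of (x, t) \<Rightarrow> \<phi> x t) / M) + rate * snd p)"
    by (rule locally_lipschitz_on_add)
  moreover have "(\<lambda>p. time_coord (\<alpha> (case p of (x, t) \<Rightarrow> \<phi> x t) / M) + rate * snd p) = (\<lambda>(x, t). backdated_coord x t)"
    by (auto simp: backdated_coord_def)
  ultimately show "locally_lipschitz_on ((G - {0}) \<times> {0..}) (\<lambda>(x, t). backdated_coord x t)" by simp
next
  fix x0 assume x0: "x0 \<in> G - {0}"
  obtain r where r: "0 < r" "\<And>x. x \<in> ball x0 r \<inter> (G - {0}) \<Longrightarrow> \<alpha> x0 / 2 < \<alpha> x \<and> \<alpha> x < 2 * \<alpha> x0"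
    using alpha_near[OF x0] by blast
  define T where "T = \<bar>time_coord (2 * \<alpha> x0) - time_coord (\<alpha> x0 / (2 * M))\<bar> / (\<epsilon> * k)"
  have ek: "0 < \<epsilon> * k" using eps k_pos by simp
  have "backdated_coord x t \<le> backdated_coord x 0" if x: "x \<in> ball x0 r \<inter> (G - {0})" and t: "T < t" for x t
  proof -
    have a: "\<alpha> x0 / 2 < \<alpha> x" "\<alpha> x < 2 * \<alpha> x0" using r(2)[OF x] by auto
    have "0 \<le> T" using ek by (simp add: T_def)
    have "backdated_coord x t \<le> time_coord (\<alpha> x) - \<epsilon> * k * t" using backdated_coord_upper[of x t] x t \<open>0 \<le> T\<close> by simp
    also have "\<dots> \<le> time_coord (2 * \<alpha> x0) - \<epsilon> * k * T"
      using a alpha_pos[OF x0] alpha_pos[of x] x t ek by (intro diff_mono mult_left_mono) (auto simp: time_coord_le_iff)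
    also have "\<epsilon> * k * T = \<bar>time_coord (2 * \<alpha> x0) - time_coord (\<alpha> x0 / (2 * M))\<bar>"
      using ek by (simp only: T_def times_divide_eq_right nonzero_mult_div_cancel_left
          less_imp_neq[THEN not_sym] not_False_eq_True)
    also have "time_coord (2 * \<alpha> x0) - \<dots> \<le> time_coord (\<alpha> x0 / (2 * M))" by simp
    also have "\<dots> \<le> time_coord (\<alpha> x / M)"
      using a alpha_pos[OF x0] alpha_pos[of x] x M by (subst time_coord_le_iff) (auto simp: field_simps)
    also have "\<dots> = backdated_coord x 0" using backdated_coord_0 x by simp
    finally show ?thesis .
  qed
  then show "\<exists>r>0. \<exists>T\<ge>0. \<forall>x\<in>ball x0 r \<inter> (G - {0}). \<forall>t>T. backdated_coord x t \<le> backdated_coord x 0"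
    using r(1) ek by (intro exI[of _ r] conjI exI[of _ T] ballI allI impI) (auto simp: T_def)
qed

lemma lyap_locally_lipschitz: "locally_lipschitz_on (G - {0}) lyap"
  unfolding locally_lipschitz_on_def
proof
  fix x0 assume x0: "x0 \<in> G - {0}"
  obtain r where r: "0 < r" "\<And>x. x \<in> ball x0 r \<inter> (G - {0}) \<Longrightarrow> \<alpha> x0 / 2 < \<alpha> x \<and> \<alpha> x < 2 * \<alpha> x0"
    using alpha_near[OF x0] by blast
  obtain r' L where r': "0 < r'" "L-lipschitz_on (ball x0 r' \<inter> (G - {0})) sup_backdated_coord"
    using sup_backdated_coord_locally_lipschitz x0 unfolding locally_lipschitz_on_def by blast
  define a b where "a = \<alpha> x0 / (2 * M)" and "b = 2 * \<alpha> x0"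
  have "0 < a" using alpha_pos[OF x0] M by (simp add: a_def)
  then obtain B where B: "0 < B"
    "\<And>v w. v \<in> {a..b} \<Longrightarrow> w \<in> {a..b} \<Longrightarrow> \<bar>v - w\<bar> \<le> B * \<bar>time_coord v - time_coord w\<bar>"
    using time_coord_inverse_lipschitz[of a b] by blast
  let ?W = "ball x0 (min r r') \<inter> (G - {0})"
  have lyap_ab: "lyap x \<in> {a..b}" if "x \<in> ?W" for x
  proof -
    have "a \<le> \<alpha> x / M" using r(2)[of x] that M by (auto simp: a_def field_simps)
    moreover have "\<alpha> x \<le> b" using r(2)[of x] that by (auto simp: b_def)
    ultimately show ?thesis using lyap_props(1,2)[of x] that by auto
  qed
  have "(B * L)-lipschitz_on ?W lyap"
  proof (rule lipschitz_onI)
    fix x y assume x: "x \<in> ?W" and y: "y \<in> ?W"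
    have "\<bar>lyap x - lyap y\<bar> \<le> B * \<bar>sup_backdated_coord x - sup_backdated_coord y\<bar>"
      using B(2)[OF lyap_ab[OF x] lyap_ab[OF y]] lyap_props(3)[of x] lyap_props(3)[of y] x y by simp
    also have "\<dots> \<le> B * (L * dist x y)"
      using lipschitz_onD[OF r'(2), of x y] x y B(1) by (intro mult_left_mono) (auto simp: dist_real_def)
    finally show "dist (lyap x) (lyap y) \<le> B * L * dist x y" by (simp add: dist_real_def mult.assoc)
  qed (use B(1) lipschitz_on_nonneg[OF r'(2)] in simp)
  then show "\<exists>r>0. \<exists>L. L-lipschitz_on (ball x0 r \<inter> (G - {0})) lyap"
    using r(1) r'(1) by (intro exI[of _ "min r r'"] conjI exI[of _ "B * L"]) auto
qed

lemma lyap_bounds: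
  assumes "x \<in> G"
  shows "0 \<le> lyap x \<and> inverse M * \<alpha> x \<le> lyap x \<and> lyap x \<le> \<alpha> x"
proof (cases "x = 0")
  case True
  then show ?thesis using alpha_zero assms by (simp add: lyap_def)
next
  case False
  then show ?thesis using lyap_props[of x] assms by (simp add: divide_inverse mult.commute)
qed

lemma lyap_continuous: "continuous_on G lyap"
  unfolding continuous_on_eq_continuous_within
proof
  fix x assume x: "x \<in> G"
  show "continuous (at x within G) lyap"
  proof (cases "x = 0")
    case False
    then have "continuous (at x within (G - {0})) lyap"
      using locally_lipschitz_on_continuous_on[OF lyap_locally_lipschitz] x by (simp add: continuous_on_eq_continuous_within)
    then show ?thesis by (simp add: continuous_within at_within_G[OF False])
  next
    case True
    have "(\<alpha> \<longlongrightarrow> 0) (at 0 within G)"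
      using alpha_continuous x alpha_zero True by (metis continuous_on_def)
    then have "(lyap \<longlongrightarrow> 0) (at 0 within G)"
    proof (rule Lim_null_comparison[rotated])
      show "\<forall>\<^sub>F x in at 0 within G. norm (lyap x) \<le> \<alpha> x"
        using lyap_bounds by (auto simp: eventually_at intro!: exI[of _ 1])
    qed
    then show ?thesis by (simp add: continuous_within True lyap_def)
  qed
qed

text \<open>At a point with a gradient, the chain rule computes the initial derivative of the time coordinate along
the orbit, and this derivative is at most \<open>- (1 - \<epsilon>) * k\<close>.\<close>

lemma lyapunov_function_lyap: "lyapunov_function f G \<alpha> \<rho> k M \<epsilon> lyap"
  unfolding lyapunov_function_def
proof (intro conjI)
  show "AE x in lebesgue. x \<in> G \<longrightarrow> (\<exists>g. (lyap has_derivative (\<lambda>h. g \<bullet> h)) (at x within G) \<and> g \<bullet> f x \<le> (1 - \<epsilon>) * k * \<rho> (lyap x))"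
    using lyap_locally_lipschitz
  proof (rule AE_gradient)
    fix x g assume x: "x \<in> G - {0}" and g: "(lyap has_derivative (\<lambda>h. g \<bullet> h)) (at x within G)"
    have x0: "\<phi> x 0 = x" using flow_0 x G_sub by blast
    have "((\<lambda>s. lyap (\<phi> x s)) has_real_derivative g \<bullet> f (\<phi> x 0)) (at 0 within {0..})"
      by (rule deriv_along_flow) (use x x0 g in auto)
    from DERIV_chain2[OF time_coord_deriv[of "lyap (\<phi> x 0)"] this]
    have "((\<lambda>s. time_coord (lyap (\<phi> x s))) has_real_derivative - 1 / \<rho> (lyap x) * (g \<bullet> f x)) (at 0 within {0..})"
      using lyap_props(4)[OF x] by (simp add: x0)
    then have "- 1 / \<rho> (lyap x) * (g \<bullet> f x) \<le> - rate"
    proof (rule deriv_le_if_linear_bound)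
      fix s :: real assume s: "0 \<le> s"
      show "time_coord (lyap (\<phi> x s)) \<le> time_coord (lyap (\<phi> x 0)) - rate * s"
        using sup_backdated_coord_flow[OF x s] lyap_props(3)[OF x] lyap_props(3)[OF flow_in_G_minus_0[OF x s]] by (simp add: x0)
    qed
    then have "g \<bullet> f x \<le> rate * \<rho> (lyap x)"
      using rho_neg[OF lyap_props(4)[OF x]] by (simp add: field_simps)
    then show "g \<bullet> f x \<le> (1 - \<epsilon>) * k * \<rho> (lyap x)" by (simp add: rate_def)
  qed
qed (use lyap_locally_lipschitz lyap_continuous lyap_bounds in auto)

end

theorem corollary21:
  fixes \<Omega> G :: "(real ^ 'n) set"
    and f :: "real ^ 'n \<Rightarrow> real ^ 'n"
    and \<phi> :: "real ^ 'n \<Rightarrow> real \<Rightarrow> real ^ 'n"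
    and \<alpha> :: "real ^ 'n \<Rightarrow> real"
    and \<rho> :: "real \<Rightarrow> real"
    and \<beta> :: "real \<Rightarrow> real \<Rightarrow> real"
    and k M :: real
  assumes "0 \<in> \<Omega>" and "f 0 = 0"
    and "solution_map \<Omega> f \<phi>"
    and "G \<subseteq> \<Omega>" and "forward_invariant \<phi> G"
    and "\<forall>x\<in>G. 0 \<le> \<alpha> x" and "continuous_on G \<alpha>"
    and "continuous_on {0<..} \<rho>"
    and "unique_comparison_solution \<rho> \<beta>"
    and "positive_definite_on G \<alpha>" and "coercive_on G \<alpha>"
    and "\<forall>y>0. strict_antimono_on {0..} (\<beta> y)"
    and "locally_lipschitz_on \<Omega> f"
    and "locally_lipschitz_on G \<alpha>"
    and "locally_lipschitz_on ({0..} \<times> {0..}) (\<lambda>(y, t). \<beta> y t)"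
    and "0 \<le> k" and "1 \<le> M"
  shows "(0 < k \<or> M = 1 \<longrightarrow>
            beta_stable_on G \<phi> \<alpha> \<beta> k M \<longrightarrow>
            (\<forall>\<epsilon>\<in>{0<..<1}. \<exists>V. lyapunov_function f G \<alpha> \<rho> k M \<epsilon> V)) \<and>
         (locally_nonnull G \<longrightarrow>
            (\<forall>\<epsilon>\<in>{0<..<1}. \<exists>V. lyapunov_function f G \<alpha> \<rho> k M \<epsilon> V) \<longrightarrow>
            beta_stable_on G \<phi> \<alpha> \<beta> k M)"
proof -
  interpret stability_setting \<Omega> f \<phi> \<rho> \<beta> G \<alpha> k M
    by unfold_locales (fact assms)+
  show ?thesis
  proof (intro conjI impI ballI)
    fix \<epsilon> :: real assume "0 < k \<or> M = 1" and stable: "beta_stable_on G \<phi> \<alpha> \<beta> k M" and \<epsilon>: "\<epsilon> \<in> {0<..<1}"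
    show "\<exists>V. lyapunov_function f G \<alpha> \<rho> k M \<epsilon> V"
    proof (cases "0 < k")
      case True
      interpret beta_stable_setting \<Omega> f \<phi> \<rho> \<beta> G \<alpha> k M \<epsilon>
        by unfold_locales (use stable True \<epsilon> in auto)
      show ?thesis using lyapunov_function_lyap by blast
    next
      case False
      then have "k = 0" "M = 1" using \<open>0 < k \<or> M = 1\<close> \<open>0 \<le> k\<close> by auto
      then show ?thesis using lyapunov_function_if_stable_k0[OF stable] by blast
    qed
  next
    assume "locally_nonnull G" "\<forall>\<epsilon>\<in>{0<..<1}. \<exists>V. lyapunov_function f G \<alpha> \<rho> k M \<epsilon> V"
    then show "beta_stable_on G \<phi> \<alpha> \<beta> k M" by (intro stable_if_lyapunov_functions) auto
  qed
qed

end
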